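(* Let $I\subset\mathbb R\setminus\{0\}$ be an open interval, $f:I\to\mathbb R$ smooth with $f'^2<1$ and $f'\neq0$ everywhere on $I$, and let $C_4\neq0$ be a real constant. Put $$\mathfrak m=-\frac{-2(f'^2-1)^3f'^2+2s(f'^2-1)f'^3f''-2s^2\left((4f'^2+1)f''^2-(f'^2-1)f'f'''\right)}{s^3f'(1-f'^2)^{7/2}},$$ $$\mathfrak n=\frac{2\left(s^2f'''(f'^2-1)+f'\left((f'^2-1)^2-3s^2f''^2\right)\right)f'-2s^2f''^2}{C_4s^3f'(f'^2-1)^3},$$ and assume that $\mathfrak m$ and $\mathfrak n$ are non-zero functions. Then the rotational hypersurface $\Gamma^s(s,t,w)=(s\cosh t\cosh w,\ s\sinh t,\ s\cosh t\sinh w,\ f(s))$ in $\mathbb E_1^4$ with Gauss map $N^{s}=-\frac{1}{\sqrt{1-f'^2}}(f'\cosh t\cosh w,\ f'\sinh t,\ f'\cosh t\sinh w,\ 1)$ has generalized $L_1$ 1-type Gauss map; namely $L_1N^s=\mathfrak mN^s+\mathfrak nC$ with $C=(0,0,0,C_4)$.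
   Context: $\mathbb E_1^4$ is $\mathbb R^4$ with the Lorentzian metric $\langle\,,\rangle=-dx_1^2+dx_2^2+dx_3^2+dx_4^2$. Let $M$ be an oriented hypersurface of $\mathbb E_1^4$ with nondegenerate induced metric $g$, unit normal vector field (Gauss map) $N$, $\varepsilon=\langle N,N\rangle=\pm1$, shape operator $S=-dN$ and principal curvatures $\kappa_1,\kappa_2,\kappa_3$. Put $a_0=1$, $a_1=-(\kappa_1+\kappa_2+\kappa_3)$, $a_2=\kappa_1\kappa_2+\kappa_1\kappa_3+\kappa_2\kappa_3$, $a_3=-\kappa_1\kappa_2\kappa_3$. The Newton transformations are $P_0=I$, $P_k=a_kI+S\circ P_{k-1}$, and $L_k(\varphi)=\mathrm{tr}(P_k\circ\nabla^2\varphi)$ for $\varphi\in C^\infty(M)$, where $\nabla^2\varphi$ is the Hessian operator of $\varphi$ with respect to $g$; $L_k$ acts componentwise on $\mathbb R^4$-valued functions such as $N$. With $n=3$, $\binom{n}{k}H_k=(-\varepsilon)^ka_k$ and $C_k=\binom{n}{k+1}(-\varepsilon)^k$, the known formula used for the Gauss map is $L_kN=-\varepsilon C_k\big(\nabla H_{k+1}+(nH_1H_{k+1}-(n-k-1)H_{k+2})N\big)$, where $\nabla$ is the gradient of $g$. $M$ has generalized $L_k$ 1-type Gauss map if $L_kN=\mathfrak mN+\mathfrak nC$ for non-zero (i.e. not identically zero) smooth functions $\mathfrak m,\mathfrak n$ on $M$ and a non-zero constant vector $C\in\mathbb E_1^4$. Primes denote $d/ds$; $s\in I$ and $t,w\in\mathbb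 R$. *)

theory Defs
  imports "HOL-Analysis.Analysis"
begin

section \<open>Smooth maps\<close>

text \<open>On an open set, being \<open>C\<^sup>\<infinity>\<close> means that all iterated directional derivatives exist and are
  (Frechet) differentiable. For real functions of one variable these are multiples of the
  iterated derivatives.\<close>

definition dir_deriv :: "'a::euclidean_space \<Rightarrow> ('a \<Rightarrow> 'b::euclidean_space) \<Rightarrow> 'a \<Rightarrow> 'b" where
  "dir_deriv v F = (\<lambda>p. frechet_derivative F (at p) v)"

definition smooth_on :: "'a::euclidean_space set \<Rightarrow> ('a \<Rightarrow> 'b::euclidean_space) \<Rightarrow> bool" where
  "smooth_on U F \<longleftrightarrow> (\<forall>vs::'a list. \<forall>p\<in>U. foldr dir_deriv vs F differentiable at p)"

abbreviation partial :: "3 \<Rightarrow> (real^3 \<Rightarrow> 'b::euclidean_space) \<Rightarrow> real^3 \<Rightarrow> 'b" where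
  "partial i \<equiv> dir_deriv (axis i 1)"

section \<open>Parametrized hypersurfaces of Minkowski 4-space\<close>

definition lorentz :: "real^4 \<Rightarrow> real^4 \<Rightarrow> real" where
  "lorentz u v = - (u$1 * v$1) + u$2 * v$2 + u$3 * v$3 + u$4 * v$4"

definition induced_metric :: "(real^3 \<Rightarrow> real^4) \<Rightarrow> real^3 \<Rightarrow> real^3^3" where
  "induced_metric X p = (\<chi> i j. lorentz (partial i X p) (partial j X p))"

text \<open>The hypersurface is \<open>X ` U\<close>. As \<open>X\<close> is injective on \<open>U\<close>, functions and tangent vector fields
  on the hypersurface are written in the global coordinates \<open>p \<in> U\<close>; \<open>N\<close> is the Gauss map.\<close>

definition oriented_hypersurface ::
    "(real^3) set \<Rightarrow> (real^3 \<Rightarrow> real^4) \<Rightarrow> (real^3 \<Rightarrow> real^4) \<Rightarrow> bool" where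
  "oriented_hypersurface U X N \<longleftrightarrow>
     open U \<and> inj_on X U \<and> smooth_on U X \<and> smooth_on U N \<and>
     (\<forall>p\<in>U. inj (frechet_derivative X (at p)) \<and> det (induced_metric X p) \<noteq> 0) \<and>
     (\<forall>p\<in>U. \<forall>v. lorentz (N p) (frechet_derivative X (at p) v) = 0) \<and>
     (\<exists>\<epsilon>\<in>{-1, 1}. \<forall>p\<in>U. lorentz (N p) (N p) = \<epsilon>)"

text \<open>Endomorphisms of the tangent space are represented by matrices \<open>A\<close> in the coordinate frame,
  the entry \<open>A$i$j\<close> being the \<open>i\<close>-th component of the image of the \<open>j\<close>-th frame vector.
  The shape operator is \<open>S = -dN\<close>, tangent vectors being identified with their images under \<open>dX\<close>.\<close>

definition shape_operator :: "(real^3 \<Rightarrow> real^4) \<Rightarrow> (real^3 \<Rightarrow> real^4) \<Rightarrow> real^3 \<Rightarrow> real^3^3" where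
  "shape_operator X N p =
     (THE A. \<forall>v. frechet_derivative X (at p) (A *v v) = - frechet_derivative N (at p) v)"

text \<open>The eigenvalues of a \<open>3 \<times> 3\<close> matrix with algebraic multiplicity, in some order. They may be
  non-real (the induced metric can be indefinite), but then come in conjugate pairs, so that their
  elementary symmetric functions are real and \<open>Re\<close> below is only a coercion.\<close>

definition principal_curvatures :: "real^3^3 \<Rightarrow> complex^3" where
  "principal_curvatures A =
     (SOME \<kappa>. \<forall>x. det (mat x - (\<chi> i j. complex_of_real (A$i$j)))
                  = (x - \<kappa>$1) * (x - \<kappa>$2) * (x - \<kappa>$3))"

definition newton_coeff :: "real^3^3 \<Rightarrow> nat \<Rightarrow> real" where
  "newton_coeff A k =
     (let \<kappa> = principal_curvatures A in
      if k = 0 then 1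
      else if k = 1 then Re (- (\<kappa>$1 + \<kappa>$2 + \<kappa>$3))
      else if k = 2 then Re (\<kappa>$1 * \<kappa>$2 + \<kappa>$1 * \<kappa>$3 + \<kappa>$2 * \<kappa>$3)
      else if k = 3 then Re (- (\<kappa>$1 * \<kappa>$2 * \<kappa>$3))
      else 0)"

primrec newton_transformation :: "real^3^3 \<Rightarrow> nat \<Rightarrow> real^3^3" where
  "newton_transformation A 0 = mat 1"
| "newton_transformation A (Suc k) =
     newton_coeff A (Suc k) *\<^sub>R mat 1 + A ** newton_transformation A k"

section \<open>Levi-Civita connection, Hessian and the operators \<open>L\<^sub>k\<close>\<close>

definition gradient :: "(real^3 \<Rightarrow> real^4) \<Rightarrow> (real^3 \<Rightarrow> real) \<Rightarrow> real^3 \<Rightarrow> real^3" where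
  "gradient X \<phi> p = matrix_inv (induced_metric X p) *v (\<chi> i. partial i \<phi> p)"

definition christoffel :: "(real^3 \<Rightarrow> real^4) \<Rightarrow> 3 \<Rightarrow> 3 \<Rightarrow> 3 \<Rightarrow> real^3 \<Rightarrow> real" where
  "christoffel X i j k p =
     (1/2) * (\<Sum>l\<in>UNIV. matrix_inv (induced_metric X p) $ i $ l *
        (partial j (\<lambda>q. induced_metric X q $ l $ k) p
         + partial k (\<lambda>q. induced_metric X q $ l $ j) p
         - partial l (\<lambda>q. induced_metric X q $ j $ k) p))"

text \<open>The endomorphism \<open>Y \<mapsto> \<nabla>\<^sub>Y V\<close>.\<close>

definition covariant_derivative ::
    "(real^3 \<Rightarrow> real^4) \<Rightarrow> (real^3 \<Rightarrow> real^3) \<Rightarrow> real^3 \<Rightarrow> real^3^3" where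
  "covariant_derivative X V p =
     (\<chi> i j. partial j (\<lambda>q. V q $ i) p + (\<Sum>k\<in>UNIV. christoffel X i j k p * V p $ k))"

definition hessian_operator :: "(real^3 \<Rightarrow> real^4) \<Rightarrow> (real^3 \<Rightarrow> real) \<Rightarrow> real^3 \<Rightarrow> real^3^3" where
  "hessian_operator X \<phi> = covariant_derivative X (gradient X \<phi>)"

definition L_op ::
    "nat \<Rightarrow> (real^3 \<Rightarrow> real^4) \<Rightarrow> (real^3 \<Rightarrow> real^4) \<Rightarrow> (real^3 \<Rightarrow> real) \<Rightarrow> real^3 \<Rightarrow> real" where
  "L_op k X N \<phi> p =
     trace (newton_transformation (shape_operator X N p) k ** hessian_operator X \<phi> p)"

definition L_op_vec ::
    "nat \<Rightarrow> (real^3 \<Rightarrow> real^4) \<Rightarrow> (real^3 \<Rightarrow> real^4) \<Rightarrow> (real^3 \<Rightarrow> real^4) \<Rightarrow> real^3 \<Rightarrow> real^4" where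
  "L_op_vec k X N F p = (\<chi> a. L_op k X N (\<lambda>q. F q $ a) p)"

definition generalized_L_1_type_Gauss_map ::
    "nat \<Rightarrow> (real^3) set \<Rightarrow> (real^3 \<Rightarrow> real^4) \<Rightarrow> (real^3 \<Rightarrow> real^4) \<Rightarrow> bool" where
  "generalized_L_1_type_Gauss_map k U X N \<longleftrightarrow>
     (\<exists>\<mm> \<nn> C. smooth_on U \<mm> \<and> smooth_on U \<nn> \<and>
        (\<exists>p\<in>U. \<mm> p \<noteq> 0) \<and> (\<exists>p\<in>U. \<nn> p \<noteq> 0) \<and> C \<noteq> 0 \<and>
        (\<forall>p\<in>U. L_op_vec k X N N p = \<mm> p *\<^sub>R N p + \<nn> p *\<^sub>R C))"

section \<open>The rotational hypersurface\<close>

text \<open>The coordinates are \<open>(s, t, w) = (p$1, p$2, p$3)\<close>.\<close>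

definition rot_surface :: "(real \<Rightarrow> real) \<Rightarrow> real^3 \<Rightarrow> real^4" where
  "rot_surface f p =
     (let s = p$1; t = p$2; w = p$3 in
      vector [s * cosh t * cosh w, s * sinh t, s * cosh t * sinh w, f s])"

definition rot_gauss :: "(real \<Rightarrow> real) \<Rightarrow> real^3 \<Rightarrow> real^4" where
  "rot_gauss f p =
     (let t = p$2; w = p$3; f1 = deriv f (p$1) in
      - (1 / sqrt (1 - f1^2)) *\<^sub>R
        vector [f1 * cosh t * cosh w, f1 * sinh t, f1 * cosh t * sinh w, 1])"

definition rot_m :: "(real \<Rightarrow> real) \<Rightarrow> real \<Rightarrow> real" where
  "rot_m f s =
     (let f1 = deriv f s; f2 = (deriv ^^ 2) f s; f3 = (deriv ^^ 3) f s in
      - ((- 2 * (f1^2 - 1)^3 * f1^2 + 2 * s * (f1^2 - 1) * f1^3 * f2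
          - 2 * s^2 * ((4 * f1^2 + 1) * f2^2 - (f1^2 - 1) * f1 * f3))
         / (s^3 * f1 * (1 - f1^2) powr (7/2))))"

definition rot_n :: "(real \<Rightarrow> real) \<Rightarrow> real \<Rightarrow> real \<Rightarrow> real" where
  "rot_n f c s =
     (let f1 = deriv f s; f2 = (deriv ^^ 2) f s; f3 = (deriv ^^ 3) f s in
      (2 * (s^2 * f3 * (f1^2 - 1) + f1 * ((f1^2 - 1)^2 - 3 * s^2 * f2^2)) * f1 - 2 * s^2 * f2^2)
      / (c * s^3 * f1 * (f1^2 - 1)^3))"

end

theory Submission
  imports Defs
begin

text \<open>The induced metric is diagonal with entries \<open>-(1 - f'\<^sup>2), s\<^sup>2, s\<^sup>2 cosh\<^sup>2 t\<close> and, with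
  \<open>\<nu> = (1 - f'\<^sup>2)\<^sup>-\<^sup>1\<^sup>/\<^sup>2\<close>, the shape operator is diagonal with entries \<open>f'' \<nu>\<^sup>3, f' \<nu> / s, f' \<nu> / s\<close>.
  Hence only the diagonal of the Hessian enters \<open>L\<^sub>1\<close>. Writing \<open>N = (h u, k)\<close> with \<open>h = - f' \<nu>\<close>, \<open>k = - \<nu>\<close>
  and \<open>u = (cosh t cosh w, sinh t, cosh t sinh w)\<close>, the components of \<open>u\<close> are eigenfunctions of the
  Laplacian of the hyperbolic plane \<open>\<langle>u, u\<rangle> = -1\<close>, so that \<open>L\<^sub>1 (h u)\<close> is a function of \<open>s\<close>
  times \<open>h u\<close>. This function is \<open>\<mm>\<close>, and \<open>C\<^sub>4 \<nn> = L\<^sub>1 k - \<mm> k\<close> since \<open>k\<close> depends on \<open>s\<close> only.\<close>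

section \<open>Calculus of smooth maps\<close>

lemma dir_deriv_has_derivative:
  "(F has_derivative D) (at p) \<Longrightarrow> dir_deriv v F p = D v"
  unfolding dir_deriv_def by (metis frechet_derivative_at)

lemma differentiable_has_dir_deriv:
  "F differentiable (at p) \<Longrightarrow> (F has_derivative (\<lambda>v. dir_deriv v F p)) (at p)"
  unfolding dir_deriv_def using frechet_derivative_works by auto

lemma differentiable_cong_open:
  assumes "open U" "p \<in> U" "\<And>q. q \<in> U \<Longrightarrow> F q = G q" "F differentiable (at p)"
  shows "G differentiable (at p)"
  using assms has_derivative_transform_within_open unfolding differentiable_def by blast

text \<open>Both functions have the same derivatives at \<open>p\<close> in the relational sense, so
  the choice made by \<open>frechet_derivative\<close> is the same for both, even where no
  derivative exists.\<close>

lemma dir_deriv_cong_open: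
  assumes "open U" "p \<in> U" "\<And>q. q \<in> U \<Longrightarrow> F q = G q"
  shows "dir_deriv v F p = dir_deriv v G p"
proof -
  have "(F has_derivative D) (at p) \<longleftrightarrow> (G has_derivative D) (at p)" for D
    using has_derivative_transform_within_open[OF _ assms(1,2)] assms(3) by metis
  then show ?thesis unfolding dir_deriv_def frechet_derivative_def by simp
qed

text \<open>A class of differentiable maps that is stable under directional derivatives contains all
  iterated derivatives of its members. Agreement on \<open>U\<close> suffices in
  \<open>step\<close>, because \<open>U\<close> is open and derivatives are local. Smoothness of a
  concrete map is thus shown by exhibiting a stable class \<open>P\<close>.\<close>

lemma smooth_on_coinduct:
  assumes "open U" "P F"
    and diff: "\<And>F p. P F \<Longrightarrow> p \<in> U \<Longrightarrow> F differentiable (at p)"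
    and step: "\<And>F v. P F \<Longrightarrow> \<exists>G. P G \<and> (\<forall>p\<in>U. dir_deriv v F p = G p)"
  shows "smooth_on U F"
proof -
  have *: "\<exists>G. P G \<and> (\<forall>p\<in>U. foldr dir_deriv vs F p = G p)" for vs
  proof (induction vs)
    case Nil then show ?case using assms(2) by auto
  next
    case (Cons v vs)
    then obtain G where G: "P G" "\<forall>p\<in>U. foldr dir_deriv vs F p = G p" by blast
    then have "\<forall>p\<in>U. foldr dir_deriv (v # vs) F p = dir_deriv v G p"
      using dir_deriv_cong_open[OF assms(1), of _ "foldr dir_deriv vs F" G] by simp
    then show ?case using step[OF G(1), of v] by auto
  qed
  show ?thesis unfolding smooth_on_def
  proof (intro allI ballI)
    fix vs p assume p: "p \<in> U"
    obtain G where G: "P G" "\<forall>p\<in>U. foldr dir_deriv vs F p = G p" using * by blast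
    show "foldr dir_deriv vs F differentiable at p"
      using differentiable_cong_open[OF assms(1) p, of G] G diff p by simp
  qed
qed

lemma smooth_on_differentiable: "smooth_on U F \<Longrightarrow> p \<in> U \<Longrightarrow> F differentiable (at p)"
  unfolding smooth_on_def by (metis foldr.simps(1) id_apply)

lemma smooth_on_dir_deriv:
  assumes "smooth_on U F" shows "smooth_on U (dir_deriv v F)"
  unfolding smooth_on_def
proof (intro allI ballI)
  fix vs p assume "p \<in> U"
  \<comment> \<open>Appending \<open>v\<close> at the end of the list makes it the innermost
    direction, that is, the one differentiated first.\<close>
  then have "foldr dir_deriv (vs @ [v]) F differentiable at p"
    using assms unfolding smooth_on_def by blast
  then show "foldr dir_deriv vs (dir_deriv v F) differentiable at p" by simp
qed

text \<open>The maps that agree on \<open>U\<close> with some smooth map form a class stable under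
  directional derivatives.\<close>

lemma smooth_on_cong:
  assumes "open U" "smooth_on U F" "\<And>p. p \<in> U \<Longrightarrow> F p = G p"
  shows "smooth_on U G"
proof (rule smooth_on_coinduct[OF assms(1), of "\<lambda>G. \<exists>F. smooth_on U F \<and> (\<forall>p\<in>U. F p = G p)"])
  show "\<exists>F. smooth_on U F \<and> (\<forall>p\<in>U. F p = G p)" using assms by blast
next
  fix G p assume "\<exists>F. smooth_on U F \<and> (\<forall>p\<in>U. F p = G p)" "p \<in> U"
  then show "G differentiable at p"
    using differentiable_cong_open[OF assms(1)] smooth_on_differentiable by blast
next
  fix G v assume "\<exists>F. smooth_on U F \<and> (\<forall>p\<in>U. F p = G p)"
  then obtain F where "smooth_on U F" "\<forall>p\<in>U. F p = G p" by blast
  then have "smooth_on U (dir_deriv v F)" "\<forall>p\<in>U. dir_deriv v G p = dir_deriv v F p"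
    using smooth_on_dir_deriv dir_deriv_cong_open[OF assms(1), of _ G F] by auto
  then show "\<exists>H. (\<exists>F. smooth_on U F \<and> (\<forall>p\<in>U. F p = H p)) \<and> (\<forall>p\<in>U. dir_deriv v G p = H p)"
    by blast
qed

lemma dir_deriv_real: "h differentiable (at x) \<Longrightarrow> dir_deriv v h x = v * deriv h x"
  for h :: "real \<Rightarrow> real"
  by (metis DERIV_deriv_iff_real_differentiable has_field_derivative_def
      dir_deriv_has_derivative mult.commute)

text \<open>On \<open>I\<close> the ordinary derivative is the directional derivative in direction
  1.\<close>

lemma smooth_on_deriv:
  fixes h :: "real \<Rightarrow> real"
  assumes "open I" "smooth_on I h" shows "smooth_on I (deriv h)"
  by (rule smooth_on_cong[OF assms(1) smooth_on_dir_deriv[OF assms(2), of 1]])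
    (simp add: dir_deriv_real smooth_on_differentiable[OF assms(2)])

text \<open>The closure of the smooth real functions under composition, sums and products is stable
  under directional derivatives, which makes \<open>smooth_on_coinduct\<close> applicable to it.\<close>

inductive smooth_closure :: "'a::euclidean_space set \<Rightarrow> ('a \<Rightarrow> real) \<Rightarrow> bool"
  for U :: "'a set" where
  base: "smooth_on U F \<Longrightarrow> smooth_closure U F"
| comp: "smooth_on V (h :: real \<Rightarrow> real) \<Longrightarrow> open V \<Longrightarrow> smooth_on U F \<Longrightarrow> F ` U \<subseteq> V
    \<Longrightarrow> smooth_closure U (\<lambda>p. h (F p))"
| add: "smooth_closure U F \<Longrightarrow> smooth_closure U G \<Longrightarrow> smooth_closure U (\<lambda>p. F p + G p)"
| mult: "smooth_closure U F \<Longrightarrow> smooth_closure U G \<Longrightarrow> smooth_closure U (\<lambda>p. F p * G p)"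

lemma has_derivative_comp_dir_deriv:
  fixes h :: "real \<Rightarrow> real"
  assumes "smooth_on V h" "smooth_on U F" "F ` U \<subseteq> V" "p \<in> U"
  shows "((\<lambda>p. h (F p)) has_derivative (\<lambda>v. deriv h (F p) * dir_deriv v F p)) (at p)"
proof -
  have "h differentiable (at (F p))"
    using assms smooth_on_differentiable by blast
  then have "(h has_derivative (*) (deriv h (F p))) (at (F p))"
    using DERIV_deriv_iff_real_differentiable has_field_derivative_def by blast
  with has_derivative_compose[OF differentiable_has_dir_deriv[of F p]] show ?thesis
    using assms smooth_on_differentiable by blast
qed

lemma smooth_closure_differentiable:
  assumes "smooth_closure U F" "p \<in> U" shows "F differentiable (at p)"
  using assms
proof (induction rule: smooth_closure.induct)
  case (comp V h F)
  then show ?case using has_derivative_comp_dir_deriv differentiable_def by blast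
qed (auto simp: smooth_on_differentiable)

lemma smooth_closure_dir_deriv:
  assumes "smooth_closure U F"
  shows "\<exists>G. smooth_closure U G \<and> (\<forall>p\<in>U. dir_deriv v F p = G p)"
  using assms
proof (induction rule: smooth_closure.induct)
  case (base F)
  then show ?case using smooth_closure.base smooth_on_dir_deriv by blast
next
  case (comp V h F)
  \<comment> \<open>The chain rule gives a product of two members: \<open>deriv h\<close> is again
    smooth on \<open>V\<close>, and since \<open>comp\<close> asks for an inner \<open>F\<close>
    that is itself smooth, \<open>dir_deriv v F\<close> enters through \<open>base\<close>.\<close>
  then have "smooth_closure U (\<lambda>p. deriv h (F p) * dir_deriv v F p)"
    by (intro smooth_closure.mult smooth_closure.comp[of V] smooth_closure.base smooth_on_deriv
        smooth_on_dir_deriv)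
  moreover have "\<forall>p\<in>U. dir_deriv v (\<lambda>p. h (F p)) p = deriv h (F p) * dir_deriv v F p"
    using dir_deriv_has_derivative[OF has_derivative_comp_dir_deriv] comp by blast
  ultimately show ?case by blast
next
  case (add F G)
  then obtain F' G' where *: "smooth_closure U F'" "smooth_closure U G'"
    "\<forall>p\<in>U. dir_deriv v F p = F' p" "\<forall>p\<in>U. dir_deriv v G p = G' p" by blast
  have "\<forall>p\<in>U. dir_deriv v (\<lambda>p. F p + G p) p = F' p + G' p"
  proof
    fix p assume p: "p \<in> U"
    note d = differentiable_has_dir_deriv[OF smooth_closure_differentiable[OF _ p]]
    show "dir_deriv v (\<lambda>p. F p + G p) p = F' p + G' p"
      using dir_deriv_has_derivative[OF has_derivative_add[OF d[OF add(1)] d[OF add(2)]], of v]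
        * p by simp
  qed
  then show ?case using smooth_closure.add[OF *(1,2)] by blast
next
  case (mult F G)
  then obtain F' G' where *: "smooth_closure U F'" "smooth_closure U G'"
    "\<forall>p\<in>U. dir_deriv v F p = F' p" "\<forall>p\<in>U. dir_deriv v G p = G' p" by blast
  have "\<forall>p\<in>U. dir_deriv v (\<lambda>p. F p * G p) p = F p * G' p + F' p * G p"
  proof
    fix p assume p: "p \<in> U"
    note d = differentiable_has_dir_deriv[OF smooth_closure_differentiable[OF _ p]]
    show "dir_deriv v (\<lambda>p. F p * G p) p = F p * G' p + F' p * G p"
      using dir_deriv_has_derivative[OF has_derivative_mult[OF d[OF mult(1)] d[OF mult(2)]], of v]
        * p by simp
  qed
  moreover have "smooth_closure U (\<lambda>p. F p * G' p + F' p * G p)"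
    using * mult by (intro smooth_closure.add smooth_closure.mult)
  ultimately show ?case by blast
qed

lemma smooth_closure_imp_smooth_on:
  assumes "open U" "smooth_closure U F" shows "smooth_on U F"
  using smooth_on_coinduct[where P="smooth_closure U", OF assms]
    smooth_closure_differentiable smooth_closure_dir_deriv by blast

lemma smooth_on_add:
  fixes F G :: "'a::euclidean_space \<Rightarrow> real"
  assumes "open U" "smooth_on U F" "smooth_on U G" shows "smooth_on U (\<lambda>p. F p + G p)"
  using smooth_closure_imp_smooth_on[OF assms(1) smooth_closure.add[OF assms(2,3)[THEN smooth_closure.base]]] .

lemma smooth_on_mult:
  fixes F G :: "'a::euclidean_space \<Rightarrow> real"
  assumes "open U" "smooth_on U F" "smooth_on U G" shows "smooth_on U (\<lambda>p. F p * G p)"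
  using smooth_closure_imp_smooth_on[OF assms(1) smooth_closure.mult[OF assms(2,3)[THEN smooth_closure.base]]] .

lemma smooth_on_compose:
  fixes F :: "'a::euclidean_space \<Rightarrow> real" and h :: "real \<Rightarrow> real"
  assumes "open U" "open V" "smooth_on V h" "smooth_on U F" "F ` U \<subseteq> V"
  shows "smooth_on U (\<lambda>p. h (F p))"
  using smooth_closure_imp_smooth_on[OF assms(1) smooth_closure.comp[OF assms(3,2,4,5)]] .

lemma smooth_on_const: "open U \<Longrightarrow> smooth_on U (\<lambda>p. c)"
  by (rule smooth_on_coinduct[of _ "\<lambda>F. \<exists>c. F = (\<lambda>p. c)"])
    (auto intro!: exI[of _ "\<lambda>p. 0"] dir_deriv_has_derivative derivative_eq_intros)

text \<open>The derivative of a linear map in direction \<open>v\<close> is the constant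
  \<open>F v\<close>, so \<open>F\<close> together with the constants is a stable class.\<close>

lemma smooth_on_bounded_linear:
  assumes "open U" "bounded_linear F" shows "smooth_on U F"
proof (rule smooth_on_coinduct[OF assms(1), of "\<lambda>G. G = F \<or> (\<exists>c. G = (\<lambda>p. c))"])
  show "F = F \<or> (\<exists>c. F = (\<lambda>p. c))" by simp
next
  fix G p assume "G = F \<or> (\<exists>c. G = (\<lambda>p. c))"
  then show "G differentiable at p" using assms(2) bounded_linear_imp_differentiable by auto
next
  fix G v assume "G = F \<or> (\<exists>c. G = (\<lambda>p. c))"
  then show "\<exists>H. (H = F \<or> (\<exists>c. H = (\<lambda>p. c))) \<and> (\<forall>p\<in>U. dir_deriv v G p = H p)"
    using dir_deriv_has_derivative[OF bounded_linear_imp_has_derivative[OF assms(2)]]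
      dir_deriv_has_derivative[OF has_derivative_const] by (metis (mono_tags, lifting))
qed

section \<open>Elementary smooth functions of one real variable\<close>

text \<open>In one variable the derivative in direction \<open>v\<close> is \<open>v\<close> times
  the ordinary derivative. Stability therefore splits into closure under differentiation and closure
  under scaling.\<close>

lemma smooth_on_real_coinduct:
  fixes h :: "real \<Rightarrow> real"
  assumes "open I" "P h"
    and step: "\<And>h. P h \<Longrightarrow> \<exists>h'. P h' \<and> (\<forall>x\<in>I. (h has_real_derivative h' x) (at x))"
    and scale: "\<And>h c. P h \<Longrightarrow> P (\<lambda>x. c * h x)"
  shows "smooth_on I h"
proof (rule smooth_on_coinduct[OF assms(1), of P])
  show "P h" by fact
next
  fix h x assume "P h" "x \<in> I"
  then show "h differentiable at x"
    using step real_differentiable_def by blast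
next
  fix h v assume "P h"
  then obtain h' where h': "P h'" "\<forall>x\<in>I. (h has_real_derivative h' x) (at x)"
    using step by blast
  then have "\<forall>x\<in>I. dir_deriv v h x = v * h' x"
    using dir_deriv_real DERIV_imp_deriv real_differentiable_def by metis
  then show "\<exists>G. P G \<and> (\<forall>x\<in>I. dir_deriv v h x = G x)" using scale[OF h'(1)] by blast
qed

lemma smooth_on_sinh_cosh:
  shows "smooth_on UNIV (sinh :: real \<Rightarrow> real)" "smooth_on UNIV (cosh :: real \<Rightarrow> real)"
proof -
  \<comment> \<open>The span of sinh and cosh is stable: differentiation interchanges the two
    coefficients.\<close>
  let ?P = "\<lambda>h::real\<Rightarrow>real. \<exists>a b. h = (\<lambda>x. a * sinh x + b * cosh x)"
  have 1: "\<exists>h'. ?P h' \<and> (\<forall>x\<in>UNIV. (h has_real_derivative h' x) (at x))" if "?P h" for h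
  proof -
    obtain a b where h: "h = (\<lambda>x. a * sinh x + b * cosh x)" using \<open>?P h\<close> by blast
    show ?thesis unfolding h
      by (rule exI[of _ "\<lambda>x. b * sinh x + a * cosh x"])
        (rule conjI, blast, auto intro!: derivative_eq_intros)
  qed
  have 2: "?P (\<lambda>x. c * h x)" if P: "?P h" for h c
  proof -
    obtain a b where h: "h = (\<lambda>x. a * sinh x + b * cosh x)" using P by blast
    show ?thesis unfolding h
      by (rule exI[of _ "c * a"], rule exI[of _ "c * b"]) (auto simp: algebra_simps)
  qed
  have "?P sinh" by (rule exI[of _ 1], rule exI[of _ 0]) auto
  from smooth_on_real_coinduct[OF open_UNIV, of ?P, OF this 1 2]
  show "smooth_on UNIV (sinh :: real \<Rightarrow> real)" .
  have "?P cosh" by (rule exI[of _ 0], rule exI[of _ 1]) auto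
  from smooth_on_real_coinduct[OF open_UNIV, of ?P, OF this 1 2]
  show "smooth_on UNIV (cosh :: real \<Rightarrow> real)" .
qed

text \<open>The stable class consists of the multiples of all real powers; differentiation lowers
  the exponent by one. This provides the half-integral powers in \<nu> and in
  \<open>rot_m\<close>.\<close>

lemma smooth_on_powr: "smooth_on {0<..} (\<lambda>x::real. x powr a)"
proof (rule smooth_on_real_coinduct[where P = "\<lambda>h. \<exists>c b. h = (\<lambda>x. c * x powr b)"])
  show "\<exists>c b. (\<lambda>x. x powr a) = (\<lambda>x. c * x powr b)" by (rule exI[of _ 1]) auto
next
  fix h :: "real \<Rightarrow> real" assume "\<exists>c b. h = (\<lambda>x. c * x powr b)"
  then obtain c b where h: "h = (\<lambda>x. c * x powr b)" by blast
  show "\<exists>h'. (\<exists>c b. h' = (\<lambda>x. c * x powr b)) \<and>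
    (\<forall>x\<in>{0<..}. (h has_real_derivative h' x) (at x))"
    unfolding h
  proof (intro exI conjI ballI)
    show "(\<lambda>x. (c * b) * x powr (b - 1)) = (\<lambda>x. (c * b) * x powr (b - 1))" ..
    fix x :: real assume "x \<in> {0<..}"
    then show "((\<lambda>x. c * x powr b) has_real_derivative c * b * x powr (b - 1)) (at x)"
      by (auto intro!: derivative_eq_intros simp: powr_diff)
  qed
next
  fix h :: "real \<Rightarrow> real" and c assume "\<exists>d b. h = (\<lambda>x. d * x powr b)"
  then obtain d b where "h = (\<lambda>x. d * x powr b)" by blast
  then show "\<exists>d b. (\<lambda>x. c * h x) = (\<lambda>x. d * x powr b)"
    by (intro exI[of _ "c * d"] exI[of _ b]) auto
qed simp

text \<open>The stable class consists of the multiples of positive powers of the inverse. It covers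
  both half-lines, as is required for quotients whose denominator may be negative.\<close>

lemma smooth_on_inverse: "smooth_on (- {0}) (inverse :: real \<Rightarrow> real)"
proof (rule smooth_on_real_coinduct[where P = "\<lambda>h. \<exists>c n. h = (\<lambda>x. c * inverse x ^ Suc n)"])
  show "\<exists>c n. inverse = (\<lambda>x::real. c * inverse x ^ Suc n)" by (intro exI[of _ 1] exI[of _ 0]) auto
next
  fix h :: "real \<Rightarrow> real" assume "\<exists>c n. h = (\<lambda>x. c * inverse x ^ Suc n)"
  then obtain c n where h: "h = (\<lambda>x. c * inverse x ^ Suc n)" by blast
  show "\<exists>h'. (\<exists>c n. h' = (\<lambda>x. c * inverse x ^ Suc n)) \<and>
    (\<forall>x\<in>- {0}. (h has_real_derivative h' x) (at x))"
    unfolding h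
  proof (intro exI conjI ballI)
    show "(\<lambda>x. (- (c * Suc n)) * inverse x ^ Suc (Suc n)) = (\<lambda>x. (- (c * Suc n)) * inverse x ^ Suc (Suc n))" ..
    fix x :: real assume "x \<in> - {0}"
    then show "((\<lambda>x. c * inverse x ^ Suc n) has_real_derivative - (c * Suc n) * inverse x ^ Suc (Suc n)) (at x)"
      using DERIV_cmult[OF DERIV_power_Suc[OF DERIV_inverse[of x UNIV], of n], of c]
      by (simp add: algebra_simps)
  qed
next
  fix h :: "real \<Rightarrow> real" and c assume "\<exists>d n. h = (\<lambda>x. d * inverse x ^ Suc n)"
  then obtain d n where "h = (\<lambda>x. d * inverse x ^ Suc n)" by blast
  then show "\<exists>d n. (\<lambda>x. c * h x) = (\<lambda>x. d * inverse x ^ Suc n)"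
    by (intro exI[of _ "c * d"] exI[of _ n]) auto
qed auto

section \<open>Closure of smooth functions under the operations used below\<close>

lemma smooth_on_cosh_compose:
  "open U \<Longrightarrow> smooth_on U F \<Longrightarrow> smooth_on U (\<lambda>p. cosh (F p :: real))"
  using smooth_on_compose[OF _ open_UNIV smooth_on_sinh_cosh(2)] by blast

lemma smooth_on_sinh_compose:
  "open U \<Longrightarrow> smooth_on U F \<Longrightarrow> smooth_on U (\<lambda>p. sinh (F p :: real))"
  using smooth_on_compose[OF _ open_UNIV smooth_on_sinh_cosh(1)] by blast

lemma smooth_on_powr_compose:
  "open U \<Longrightarrow> smooth_on U F \<Longrightarrow> (\<And>p. p \<in> U \<Longrightarrow> F p > 0)
    \<Longrightarrow> smooth_on U (\<lambda>p. (F p :: real) powr a)"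
  using smooth_on_compose[OF _ _ smooth_on_powr] by (metis greaterThan_iff image_subsetI open_greaterThan)

lemma smooth_on_minus:
  fixes F :: "'a::euclidean_space \<Rightarrow> real"
  assumes "open U" "smooth_on U F" shows "smooth_on U (\<lambda>p. - F p)"
  using smooth_on_mult[OF assms(1) smooth_on_const[OF assms(1), of "-1"] assms(2)] by simp

lemma smooth_on_diff:
  fixes F G :: "'a::euclidean_space \<Rightarrow> real"
  assumes "open U" "smooth_on U F" "smooth_on U G" shows "smooth_on U (\<lambda>p. F p - G p)"
  using smooth_on_add[OF assms(1,2) smooth_on_minus[OF assms(1,3)]] by simp

lemma smooth_on_divide:
  fixes F G :: "'a::euclidean_space \<Rightarrow> real"
  assumes "open U" "smooth_on U F" "smooth_on U G" "\<And>p. p \<in> U \<Longrightarrow> G p \<noteq> 0"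
  shows "smooth_on U (\<lambda>p. F p / G p)"
proof -
  have "smooth_on U (\<lambda>p. inverse (G p))"
    using assms smooth_on_compose[OF _ _ smooth_on_inverse, of U G] by fastforce
  from smooth_on_mult[OF assms(1,2) this] show ?thesis by (simp add: divide_inverse)
qed

lemma smooth_on_power:
  fixes F :: "'a::euclidean_space \<Rightarrow> real"
  assumes "open U" "smooth_on U F" shows "smooth_on U (\<lambda>p. F p ^ n)"
  by (induction n) (auto intro: smooth_on_mult smooth_on_const assms)

lemma differentiable_vec_nth:
  fixes F :: "'a::euclidean_space \<Rightarrow> real^'n"
  assumes "F differentiable (at p)" shows "(\<lambda>p. F p $ i) differentiable (at p)"
    and "dir_deriv v (\<lambda>p. F p $ i) p = dir_deriv v F p $ i"
proof -
  have "((\<lambda>p. F p $ i) has_derivative (\<lambda>v. dir_deriv v F p $ i)) (at p)"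
    using bounded_linear.has_derivative[OF bounded_linear_vec_nth
        differentiable_has_dir_deriv[OF assms]] .
  then show "(\<lambda>p. F p $ i) differentiable (at p)"
    and "dir_deriv v (\<lambda>p. F p $ i) p = dir_deriv v F p $ i"
    using dir_deriv_has_derivative differentiable_def by blast+
qed

lemma differentiable_vecI:
  fixes F :: "'a::euclidean_space \<Rightarrow> real^'n"
  assumes "\<And>i. (\<lambda>p. F p $ i) differentiable (at p)"
  shows "F differentiable (at p)"
  using assms by (subst differentiable_componentwise_within) (auto simp: Basis_vec_def inner_axis)

text \<open>Taking components commutes with directional derivatives, so the maps with smooth
  components form a stable class.\<close>

lemma smooth_on_vecI:
  fixes F :: "'a::euclidean_space \<Rightarrow> real^'n"
  assumes "open U" "\<And>i. smooth_on U (\<lambda>p. F p $ i)"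
  shows "smooth_on U F"
proof (rule smooth_on_coinduct[OF assms(1), of "\<lambda>F. \<forall>i. smooth_on U (\<lambda>p. F p $ i)"])
  show "\<forall>i. smooth_on U (\<lambda>p. F p $ i)" using assms by blast
next
  fix F :: "'a \<Rightarrow> real^'n" and p assume "\<forall>i. smooth_on U (\<lambda>p. F p $ i)" "p \<in> U"
  then show "F differentiable at p"
    by (intro differentiable_vecI smooth_on_differentiable[where U = U]) auto
next
  fix F :: "'a \<Rightarrow> real^'n" and v assume F: "\<forall>i. smooth_on U (\<lambda>p. F p $ i)"
  have "smooth_on U (\<lambda>p. dir_deriv v F p $ i)" for i
  proof (rule smooth_on_cong[OF assms(1)])
    show "smooth_on U (dir_deriv v (\<lambda>p. F p $ i))" using F smooth_on_dir_deriv by blast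
    fix p assume "p \<in> U"
    then have "F differentiable at p"
      using F smooth_on_differentiable by (intro differentiable_vecI) blast
    then show "dir_deriv v (\<lambda>p. F p $ i) p = dir_deriv v F p $ i"
      by (rule differentiable_vec_nth(2))
  qed
  then show "\<exists>G. (\<forall>i. smooth_on U (\<lambda>p. G p $ i)) \<and> (\<forall>p\<in>U. dir_deriv v F p = G p)"
    by (intro exI[of _ "dir_deriv v F"]) simp
qed

section \<open>Orthogonal metrics with diagonal shape operator\<close>

lemma vector_4 [simp]:
  "(vector [x,y,z,w] :: ('a::zero)^4)$1 = x"
  "(vector [x,y,z,w] :: ('a::zero)^4)$2 = y"
  "(vector [x,y,z,w] :: ('a::zero)^4)$3 = z"
  "(vector [x,y,z,w] :: ('a::zero)^4)$4 = w"
  unfolding vector_def by simp_all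

section \<open>Diagonal matrices and the first Newton transformation\<close>

definition diag_mat :: "'a::zero^'n \<Rightarrow> 'a^'n^'n" where
  "diag_mat d = (\<chi> i j. if i = j then d$i else 0)"

lemma diag_mat_mult_left: "(diag_mat d ** A) $ i $ j = d$i * A$i$j" for d :: "real^'n"
  by (simp add: diag_mat_def matrix_matrix_mult_def if_distrib[of "\<lambda>x. x * _"] cong: if_cong)

lemma diag_mat_mult_vec: "(diag_mat d *v v) $ i = d$i * v$i" for d :: "real^'n"
  by (simp add: diag_mat_def matrix_vector_mult_def if_distrib[of "\<lambda>x. x * _"] cong: if_cong)

lemma matrix_inv_diag_mat:
  fixes d :: "real^'n"
  assumes "\<And>i. d$i \<noteq> 0"
  shows "matrix_inv (diag_mat d) = diag_mat (\<chi> i. 1 / d$i)"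
proof -
  let ?E = "diag_mat (\<chi> i. 1 / d$i)"
  have 1: "diag_mat d ** ?E = mat 1"
    unfolding vec_eq_iff diag_mat_mult_left
    using assms by (simp add: diag_mat_def mat_def)
  have 2: "?E ** diag_mat d = mat 1"
    unfolding vec_eq_iff diag_mat_mult_left
    using assms by (simp add: diag_mat_def mat_def)
  \<comment> \<open>\<open>matrix_inv\<close> is a choice among two-sided inverses, so it is first
    shown to be one, with \<open>?E\<close> as witness; uniqueness of inverses then identifies it
    with \<open>?E\<close>.\<close>
  have "matrix_inv (diag_mat d) ** diag_mat d = mat 1"
    unfolding matrix_inv_def using someI[of "\<lambda>E. diag_mat d ** E = mat 1 \<and> E ** diag_mat d = mat 1", OF conjI[OF 1 2]]
    by blast
  then show ?thesis by (metis 1 matrix_mul_assoc matrix_mul_lid matrix_mul_rid)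
qed

lemma det_diag_mat: "det (diag_mat d) = (\<Prod>i\<in>UNIV. d$i)"
  for d :: "'a::comm_ring_1^'n"
  by (subst det_diagonal) (simp_all add: diag_mat_def)

text \<open>The triple \<open>principal_curvatures A\<close> is an arbitrary choice, known only
  through the factorization of the characteristic polynomial. The sum of its entries is a
  coefficient of that polynomial and hence independent of the order chosen.\<close>

lemma newton_coeff_diag_mat: "newton_coeff (diag_mat d) 1 = - (d$1 + d$2 + d$3)"
proof -
  define A where "A = diag_mat d"
  let ?d = "\<lambda>i. complex_of_real (d$i)"
  have mat: "mat x - (\<chi> i j. complex_of_real (A$i$j)) = diag_mat (\<chi> i. x - ?d i)" for x
    by (simp add: vec_eq_iff mat_def diag_mat_def A_def)
  have prod3: "(\<Prod>i\<in>UNIV. c i) = c 1 * c 2 * c 3" for c :: "3 \<Rightarrow> complex"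
    unfolding UNIV_3 by (simp add: mult.assoc)
  have char: "det (mat x - (\<chi> i j. complex_of_real (A$i$j)))
      = (x - ?d 1) * (x - ?d 2) * (x - ?d 3)" for x
    unfolding mat det_diag_mat prod3 by simp
  define \<kappa> where "\<kappa> = principal_curvatures A"
  have "\<exists>\<kappa>::complex^3. \<forall>x. det (mat x - (\<chi> i j. complex_of_real (A$i$j)))
      = (x - \<kappa>$1) * (x - \<kappa>$2) * (x - \<kappa>$3)"
    unfolding char by (rule exI[of _ "vector [?d 1, ?d 2, ?d 3]"]) simp
  then have "\<forall>x. det (mat x - (\<chi> i j. complex_of_real (A$i$j)))
      = (x - \<kappa>$1) * (x - \<kappa>$2) * (x - \<kappa>$3)"
    unfolding \<kappa>_def principal_curvatures_def by (rule someI_ex)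
  then have eq: "(x - ?d 1) * (x - ?d 2) * (x - ?d 3) = (x - \<kappa>$1) * (x - \<kappa>$2) * (x - \<kappa>$3)" for x
    unfolding char by blast
  \<comment> \<open>For a monic cubic P, the value P(1) + P(-1) - 2 P(0) is twice the coefficient of
    x^2, that is, minus twice the sum of the roots.\<close>
  have "2 * (\<kappa>$1 + \<kappa>$2 + \<kappa>$3) = 2 * (?d 1 + ?d 2 + ?d 3)"
    using eq[of 0] eq[of 1] eq[of "-1"] by algebra
  then have "\<kappa>$1 + \<kappa>$2 + \<kappa>$3 = complex_of_real (d$1 + d$2 + d$3)"
    by (subst (asm) mult_cancel_left) simp
  then show ?thesis
    unfolding newton_coeff_def Let_def A_def[symmetric] \<kappa>_def[symmetric]
    using Re_complex_of_real by (metis (no_types) one_neq_zero of_real_minus)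
qed

text \<open>As P_1 = a_1 I + S, each diagonal entry is minus the sum of the other two
  eigenvalues.\<close>

lemma newton_transformation_diag_mat:
  "newton_transformation (diag_mat d) 1 = diag_mat (\<chi> i. d$i - (d$1 + d$2 + d$3))"
proof -
  have "newton_transformation (diag_mat d) 1 = newton_coeff (diag_mat d) 1 *\<^sub>R mat 1 + diag_mat d"
    by simp
  then show ?thesis unfolding newton_coeff_diag_mat
    by (simp add: vec_eq_iff mat_def diag_mat_def)
qed

lemma diag_mat_nth: "diag_mat d $ i $ j = (if i = j then d$i else 0)"
  by (simp add: diag_mat_def)

lemma partial_zero: "partial k (\<lambda>q. 0) p = 0"
  by (rule dir_deriv_has_derivative) (rule has_derivative_const)

text \<open>For an orthogonal metric \<open>\<Gamma>\<^sup>i\<^sub>i\<^sub>k = \<partial>\<^sub>k g\<^sub>i\<^sub>i / (2 g\<^sub>i\<^sub>i)\<close>.\<close>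

lemma L_op_1_orthogonal:
  assumes U: "open U" "p \<in> U"
    and g: "\<And>q. q \<in> U \<Longrightarrow> induced_metric X q = diag_mat (g q)"
    and g0: "\<And>q i. q \<in> U \<Longrightarrow> g q $ i \<noteq> 0"
    and S: "shape_operator X N p = diag_mat \<kappa>"
  shows "L_op 1 X N \<phi> p = (\<Sum>i\<in>UNIV. (\<kappa>$i - (\<kappa>$1 + \<kappa>$2 + \<kappa>$3)) *
      (partial i (\<lambda>q. partial i \<phi> q / g q $ i) p
       + (\<Sum>k\<in>UNIV. partial k (\<lambda>q. g q $ i) p / (2 * g p $ i) * (partial k \<phi> p / g p $ k))))"
proof -
  have inv: "matrix_inv (induced_metric X q) = diag_mat (\<chi> i. 1 / g q $ i)" if "q \<in> U" for q
    using matrix_inv_diag_mat[of "g q"] g g0 that by simp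
  have grad: "gradient X \<phi> q $ i = partial i \<phi> q / g q $ i" if "q \<in> U" for q i
    using inv[OF that] by (simp add: gradient_def diag_mat_mult_vec)
  have metric: "partial k (\<lambda>q. induced_metric X q $ i $ j) p
      = (if i = j then partial k (\<lambda>q. g q $ i) p else 0)" for i j k
    using dir_deriv_cong_open[OF U, of "\<lambda>q. induced_metric X q $ i $ j"
        "\<lambda>q. if i = j then g q $ i else 0"] g
    by (simp add: diag_mat_nth partial_zero)
  \<comment> \<open>The diagonal inverse leaves only the summand with \<open>l = i\<close>; there
    the first and the third derivative are both \<open>partial i\<close> of the entry
    \<open>(i, k)\<close> and cancel.\<close>
  have christoffel: "christoffel X i i k p = partial k (\<lambda>q. g q $ i) p / (2 * g p $ i)" for i k
    unfolding christoffel_def inv[OF U(2)] metric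
    by (simp add: diag_mat_nth if_distrib[of "\<lambda>x. x * _"] cong: if_cong)
  have "hessian_operator X \<phi> p $ i $ i = partial i (\<lambda>q. partial i \<phi> q / g q $ i) p
       + (\<Sum>k\<in>UNIV. partial k (\<lambda>q. g q $ i) p / (2 * g p $ i) * (partial k \<phi> p / g p $ k))" for i
    unfolding hessian_operator_def covariant_derivative_def
    using dir_deriv_cong_open[OF U, of "\<lambda>q. gradient X \<phi> q $ i"] grad U(2)
    by (simp add: christoffel)
  then show ?thesis
    unfolding L_op_def S newton_transformation_diag_mat trace_def diag_mat_mult_left by simp
qed

section \<open>Differentiation of products of functions of one coordinate each\<close>

text \<open>The components of the immersion and of its Gauss map and the diagonal metric entries all
  have this form, missing factors being the constant 1. Their derivatives are all obtained from this
  product rule.\<close>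

lemma separable_has_derivative:
  fixes h a b :: "real \<Rightarrow> real" and p :: "real^3"
  assumes "(h has_real_derivative h') (at (p$1))" "(a has_real_derivative a') (at (p$2))"
    "(b has_real_derivative b') (at (p$3))"
  shows "((\<lambda>p. h (p$1) * a (p$2) * b (p$3)) has_derivative
    (\<lambda>v. v$1 * (h' * a (p$2) * b (p$3)) + v$2 * (h (p$1) * a' * b (p$3))
       + v$3 * (h (p$1) * a (p$2) * b'))) (at p)"
proof -
  have *: "((\<lambda>p. k (p$i)) has_derivative (\<lambda>v. k' * v$i)) (at p)"
    if "(k has_real_derivative k') (at (p$i))" for k k' and i :: 3
    using has_derivative_compose[OF bounded_linear_imp_has_derivative[OF bounded_linear_vec_nth]]
      that[unfolded has_field_derivative_def] by blast
  show ?thesis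
    by (rule has_derivative_eq_rhs[OF has_derivative_mult[OF has_derivative_mult[OF
            *[OF assms(1)] *[OF assms(2)]] *[OF assms(3)]]])
      (simp add: algebra_simps)
qed

lemma partial_separable:
  fixes h a b :: "real \<Rightarrow> real" and p :: "real^3"
  assumes "(h has_real_derivative h') (at (p$1))" "(a has_real_derivative a') (at (p$2))"
    "(b has_real_derivative b') (at (p$3))"
  shows "partial 1 (\<lambda>p. h (p$1) * a (p$2) * b (p$3)) p = h' * a (p$2) * b (p$3)"
    "partial 2 (\<lambda>p. h (p$1) * a (p$2) * b (p$3)) p = h (p$1) * a' * b (p$3)"
    "partial 3 (\<lambda>p. h (p$1) * a (p$2) * b (p$3)) p = h (p$1) * a (p$2) * b'"
  by (simp_all add: dir_deriv_has_derivative[OF separable_has_derivative[OF assms]] axis_def)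

section \<open>Rotational hypersurfaces\<close>

text \<open>Turns the real power in \<open>rot_m\<close> into an integral power of \<nu>, so that
  polynomial algebra applies.\<close>

lemma powr_seven_halves:
  fixes W \<nu> :: real
  assumes "W > 0" "\<nu> = 1 / sqrt W"
  shows "W powr (7/2) = 1 / \<nu>^7"
proof -
  have "sqrt W ^ 7 = W powr (7/2)"
    using assms(1) by (simp add: powr_half_sqrt[symmetric] powr_realpow[symmetric] powr_powr)
  then show ?thesis by (simp add: assms(2) power_divide)
qed

lemma DERIV_cosh_real: "(cosh has_real_derivative sinh x) (at x)"
  and DERIV_sinh_real: "(sinh has_real_derivative cosh x) (at x)"
  by (auto intro!: derivative_eq_intros)

section \<open>The profile function and the derivatives of \<nu>\<close>

locale rot_profile =
  fixes I :: "real set" and f :: "real \<Rightarrow> real"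
  assumes open_I: "open I" and zero_notin: "0 \<notin> I" and smooth_f: "smooth_on I f"
    and slope: "s \<in> I \<Longrightarrow> (deriv f s)^2 < 1"
begin

abbreviation "f1 \<equiv> deriv f"
abbreviation "f2 \<equiv> deriv f1"
abbreviation "f3 \<equiv> deriv f2"

definition "\<nu> s = 1 / sqrt (1 - (f1 s)^2)"
definition "U = {p::real^3. p$1 \<in> I}"
definition "X\<^sub>s p = (vector [cosh (p$2) * cosh (p$3), sinh (p$2), cosh (p$2) * sinh (p$3), f1 (p$1)] :: real^4)"
  for p :: "real^3"
definition "X\<^sub>t p = (vector [p$1 * sinh (p$2) * cosh (p$3), p$1 * cosh (p$2), p$1 * sinh (p$2) * sinh (p$3), 0] :: real^4)"
  for p :: "real^3"
definition "X\<^sub>w p = (vector [p$1 * cosh (p$2) * sinh (p$3), 0, p$1 * cosh (p$2) * cosh (p$3), 0] :: real^4)"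
  for p :: "real^3"
definition "rot_metric p = (vector [- (1 - (f1 (p$1))^2), (p$1)^2, (p$1)^2 * (cosh (p$2))^2] :: real^3)"
  for p :: "real^3"
definition "\<kappa>1 s = f2 s * (\<nu> s)^3"
definition "\<kappa>2 s = f1 s * \<nu> s / s"

lemma open_U: "open U"
  unfolding U_def using continuous_open_vimage[OF open_I, of "\<lambda>p::real^3. p$1"]
  by (simp add: vimage_def continuous_intros)

lemma smooth_f123: "smooth_on I f1" "smooth_on I f2" "smooth_on I f3"
  by (auto intro!: smooth_on_deriv open_I smooth_f)

lemma smooth_on_DERIV: "smooth_on I h \<Longrightarrow> s \<in> I \<Longrightarrow> (h has_real_derivative deriv h s) (at s)"
  using smooth_on_differentiable DERIV_deriv_iff_real_differentiable by blast

lemma DERIV_f: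
  assumes "s \<in> I"
  shows "(f has_real_derivative f1 s) (at s)" "(f1 has_real_derivative f2 s) (at s)"
    "(f2 has_real_derivative f3 s) (at s)"
  using smooth_f smooth_f123 smooth_on_DERIV assms by blast+

lemma slope_pos: "s \<in> I \<Longrightarrow> 1 - (f1 s)^2 > 0" using slope by fastforce

lemma \<nu>_pos: "s \<in> I \<Longrightarrow> \<nu> s > 0" using slope_pos by (simp add: \<nu>_def)

lemma \<nu>_squared: "s \<in> I \<Longrightarrow> (\<nu> s)^2 = 1 / (1 - (f1 s)^2)"
  using slope_pos by (simp add: \<nu>_def power_divide less_imp_le)

lemma DERIV_\<nu>:
  assumes "s \<in> I" shows "(\<nu> has_real_derivative f1 s * f2 s * (\<nu> s)^3) (at s)"
proof -
  let ?W = "1 - (f1 s)^2"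
  have "((\<lambda>s. 1 / sqrt (1 - (f1 s)^2)) has_real_derivative f1 s * f2 s * (1 / sqrt ?W)^3) (at s)"
    using slope_pos[OF assms]
    by (auto intro!: derivative_eq_intros assms DERIV_f(2)[OF assms] simp: field_simps power3_eq_cube)
  then show ?thesis unfolding \<nu>_def .
qed

text \<open>The product rule gives f'' \<nu> + f'^2 f'' \<nu>^3 up to sign, and 1 + f'^2 \<nu>^2 =
  \<nu>^2.\<close>

lemma DERIV_f1_\<nu>:
  assumes "s \<in> I" shows "((\<lambda>s. - (f1 s * \<nu> s)) has_real_derivative - (f2 s * (\<nu> s)^3)) (at s)"
proof -
  have "((\<lambda>s. - (f1 s * \<nu> s)) has_real_derivative - (f1 s * (f1 s * f2 s * (\<nu> s)^3) + f2 s * \<nu> s)) (at s)"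
    using DERIV_minus[OF DERIV_mult[OF DERIV_f(2)[OF assms] DERIV_\<nu>[OF assms]]]
    by (simp add: algebra_simps)
  moreover have "(\<nu> s)^2 * (1 - (f1 s)^2) = 1"
    using slope_pos[OF assms] by (simp add: \<nu>_squared[OF assms])
  then have "f1 s * (f1 s * f2 s * (\<nu> s)^3) + f2 s * \<nu> s = f2 s * (\<nu> s)^3"
    by algebra
  ultimately show ?thesis by simp
qed

section \<open>Coordinate frame, induced metric and shape operator\<close>

lemma cosh_square: "(cosh x)^2 = (sinh x)^2 + 1" for x :: real
  using hyperbolic_pythagoras[of x] by simp

lemma has_derivative_vec4I:
  fixes F :: "real^3 \<Rightarrow> real^4"
  assumes "\<And>i. ((\<lambda>p. F p $ i) has_derivative (\<lambda>v. D v $ i)) (at p)"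
  shows "(F has_derivative D) (at p)"
  using assms by (subst has_derivative_componentwise_within) (auto simp: Basis_vec_def inner_axis)

lemma rot_surface_has_derivative:
  assumes "p \<in> U"
  shows "(rot_surface f has_derivative (\<lambda>v. v$1 *\<^sub>R X\<^sub>s p + v$2 *\<^sub>R X\<^sub>t p + v$3 *\<^sub>R X\<^sub>w p)) (at p)"
proof (rule has_derivative_vec4I)
  have s: "p$1 \<in> I" using assms by (simp add: U_def)
  note id = DERIV_ident[of "at _"] and f = DERIV_f(1)[OF s] and one = DERIV_const[of 1 "at _"]
    and ch = DERIV_cosh_real and sh = DERIV_sinh_real
  fix i :: 4
  consider "i = 1" | "i = 2" | "i = 3" | "i = 4" using exhaust_4 by blast
  then show "((\<lambda>p. rot_surface f p $ i) has_derivative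
      (\<lambda>v. (v$1 *\<^sub>R X\<^sub>s p + v$2 *\<^sub>R X\<^sub>t p + v$3 *\<^sub>R X\<^sub>w p) $ i)) (at p)"
    unfolding rot_surface_def Let_def X\<^sub>s_def X\<^sub>t_def X\<^sub>w_def
    using separable_has_derivative[OF id ch ch, of p] separable_has_derivative[OF id sh one, of p]
      separable_has_derivative[OF id ch sh, of p] separable_has_derivative[OF f one one]
    by cases (simp_all add: ac_simps)
qed

lemma rot_gauss_nth:
  "rot_gauss f p $ 1 = - (f1 (p$1) * \<nu> (p$1)) * cosh (p$2) * cosh (p$3)"
  "rot_gauss f p $ 2 = - (f1 (p$1) * \<nu> (p$1)) * sinh (p$2) * 1"
  "rot_gauss f p $ 3 = - (f1 (p$1) * \<nu> (p$1)) * cosh (p$2) * sinh (p$3)"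
  "rot_gauss f p $ 4 = - \<nu> (p$1) * 1 * 1"
  by (simp_all add: rot_gauss_def Let_def \<nu>_def)

text \<open>The Weingarten formulas. Along s, the derivatives of h and k are
  \<open>- \<kappa>1\<close> and \<open>- \<kappa>1 * f1\<close>, which assembles to
  \<open>- \<kappa>1\<close> times \<open>X\<^sub>s\<close>. In the directions t and w only u is
  differentiated, and h is \<open>- \<kappa>2\<close> times s, the factor s being that of
  \<open>X\<^sub>t\<close> and \<open>X\<^sub>w\<close>.\<close>

lemma rot_gauss_has_derivative:
  assumes "p \<in> U"
  shows "(rot_gauss f has_derivative (\<lambda>v. - (v$1 * \<kappa>1 (p$1)) *\<^sub>R X\<^sub>s p - (v$2 * \<kappa>2 (p$1)) *\<^sub>R X\<^sub>t p
    - (v$3 * \<kappa>2 (p$1)) *\<^sub>R X\<^sub>w p)) (at p)"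
proof (rule has_derivative_vec4I)
  have s: "p$1 \<in> I" using assms by (simp add: U_def)
  then have s0: "p$1 \<noteq> 0" using zero_notin by auto
  note id = DERIV_ident[of "at _"] and h = DERIV_f1_\<nu>[OF s] and one = DERIV_const[of 1 "at _"]
    and ch = DERIV_cosh_real and sh = DERIV_sinh_real and k = DERIV_minus[OF DERIV_\<nu>[OF s]]
  fix i :: 4
  consider "i = 1" | "i = 2" | "i = 3" | "i = 4" using exhaust_4 by blast
  then show "((\<lambda>p. rot_gauss f p $ i) has_derivative
      (\<lambda>v. (- (v$1 * \<kappa>1 (p$1)) *\<^sub>R X\<^sub>s p - (v$2 * \<kappa>2 (p$1)) *\<^sub>R X\<^sub>t p
        - (v$3 * \<kappa>2 (p$1)) *\<^sub>R X\<^sub>w p) $ i)) (at p)"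
  proof cases
    case 1 show ?thesis unfolding 1 rot_gauss_nth
      by (rule has_derivative_eq_rhs[OF separable_has_derivative[OF h ch ch]])
        (use s0 in \<open>auto simp: X\<^sub>s_def X\<^sub>t_def X\<^sub>w_def \<kappa>1_def \<kappa>2_def\<close>)
  next
    case 2 show ?thesis unfolding 2 rot_gauss_nth
      by (rule has_derivative_eq_rhs[OF separable_has_derivative[OF h sh one]])
        (use s0 in \<open>auto simp: X\<^sub>s_def X\<^sub>t_def X\<^sub>w_def \<kappa>1_def \<kappa>2_def\<close>)
  next
    case 3 show ?thesis unfolding 3 rot_gauss_nth
      by (rule has_derivative_eq_rhs[OF separable_has_derivative[OF h ch sh]])
        (use s0 in \<open>auto simp: X\<^sub>s_def X\<^sub>t_def X\<^sub>w_def \<kappa>1_def \<kappa>2_def\<close>)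
  next
    case 4 show ?thesis unfolding 4 rot_gauss_nth
      by (rule has_derivative_eq_rhs[OF separable_has_derivative[OF k one one]])
        (use s0 in \<open>auto simp: X\<^sub>s_def X\<^sub>t_def X\<^sub>w_def \<kappa>1_def \<kappa>2_def\<close>)
  qed
qed

lemma lorentz_frame:
  "lorentz (X\<^sub>s p) (X\<^sub>s p) = rot_metric p $ 1" "lorentz (X\<^sub>t p) (X\<^sub>t p) = rot_metric p $ 2"
  "lorentz (X\<^sub>w p) (X\<^sub>w p) = rot_metric p $ 3" "lorentz (X\<^sub>s p) (X\<^sub>t p) = 0"
  "lorentz (X\<^sub>s p) (X\<^sub>w p) = 0" "lorentz (X\<^sub>t p) (X\<^sub>w p) = 0"
  using cosh_square[of "p$2"] cosh_square[of "p$3"]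
  by (simp_all add: lorentz_def X\<^sub>s_def X\<^sub>t_def X\<^sub>w_def rot_metric_def power2_eq_square) algebra+

lemma lorentz_linear:
  "lorentz u v = lorentz v u"
  "lorentz (x + y) v = lorentz x v + lorentz y v" "lorentz (c *\<^sub>R x) v = c * lorentz x v"
  by (simp_all add: lorentz_def algebra_simps)

lemma rot_surface_frechet:
  "p \<in> U \<Longrightarrow> frechet_derivative (rot_surface f) (at p) v = v$1 *\<^sub>R X\<^sub>s p + v$2 *\<^sub>R X\<^sub>t p + v$3 *\<^sub>R X\<^sub>w p"
  using dir_deriv_has_derivative[OF rot_surface_has_derivative] unfolding dir_deriv_def .

lemma rot_gauss_frechet:
  "p \<in> U \<Longrightarrow> frechet_derivative (rot_gauss f) (at p) v = - (v$1 * \<kappa>1 (p$1)) *\<^sub>R X\<^sub>s p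
     - (v$2 * \<kappa>2 (p$1)) *\<^sub>R X\<^sub>t p - (v$3 * \<kappa>2 (p$1)) *\<^sub>R X\<^sub>w p"
  using dir_deriv_has_derivative[OF rot_gauss_has_derivative] unfolding dir_deriv_def .

lemma rot_metric_nonzero:
  assumes "p \<in> U" shows "rot_metric p $ i \<noteq> 0"
proof -
  have "1 - (f1 (p$1))^2 \<noteq> 0" "p$1 \<noteq> 0"
    using assms slope_pos[of "p$1"] zero_notin by (auto simp: U_def)
  then have "\<forall>i. rot_metric p $ i \<noteq> 0"
    unfolding forall_3 by (simp add: rot_metric_def)
  then show ?thesis by blast
qed

lemma induced_metric_rot_surface:
  assumes "p \<in> U" shows "induced_metric (rot_surface f) p = diag_mat (rot_metric p)"
  unfolding induced_metric_def dir_deriv_def rot_surface_frechet[OF assms] vec_eq_iff forall_3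
    diag_mat_nth
  by (simp add: axis_def lorentz_frame lorentz_linear(1)[of "X\<^sub>t p" "X\<^sub>s p"]
      lorentz_linear(1)[of "X\<^sub>w p"])

text \<open>The frame is Lorentz-orthogonal and none of its vectors is null, so pairing with a frame
  vector isolates one coordinate.\<close>

lemma inj_rot_surface_frechet:
  assumes "p \<in> U" shows "inj (frechet_derivative (rot_surface f) (at p))"
proof (rule injI)
  fix v w assume eq: "frechet_derivative (rot_surface f) (at p) v = frechet_derivative (rot_surface f) (at p) w"
  have "v$1 * rot_metric p $ 1 = w$1 * rot_metric p $ 1" "v$2 * rot_metric p $ 2 = w$2 * rot_metric p $ 2"
    "v$3 * rot_metric p $ 3 = w$3 * rot_metric p $ 3"
    using arg_cong[OF eq[unfolded rot_surface_frechet[OF assms]], of "\<lambda>x. lorentz x (X\<^sub>s p)"]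
      arg_cong[OF eq[unfolded rot_surface_frechet[OF assms]], of "\<lambda>x. lorentz x (X\<^sub>t p)"]
      arg_cong[OF eq[unfolded rot_surface_frechet[OF assms]], of "\<lambda>x. lorentz x (X\<^sub>w p)"]
    by (simp_all add: lorentz_linear(2,3) lorentz_frame lorentz_linear(1)[of "X\<^sub>t p" "X\<^sub>s p"]
      lorentz_linear(1)[of "X\<^sub>w p"])
  then show "v = w" using rot_metric_nonzero[OF assms] by (simp add: vec_eq_iff forall_3)
qed

text \<open>The Weingarten formulas show that this matrix satisfies the description; injectivity of
  the differential shows that no other matrix does.\<close>

lemma shape_operator_rot_surface:
  assumes "p \<in> U"
  shows "shape_operator (rot_surface f) (rot_gauss f) p
    = diag_mat (vector [\<kappa>1 (p$1), \<kappa>2 (p$1), \<kappa>2 (p$1)])" (is "_ = diag_mat ?\<kappa>")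
  unfolding shape_operator_def
proof (rule the_equality)
  show eq: "\<forall>v. frechet_derivative (rot_surface f) (at p) (diag_mat ?\<kappa> *v v)
      = - frechet_derivative (rot_gauss f) (at p) v"
    by (simp add: rot_surface_frechet rot_gauss_frechet assms diag_mat_mult_vec mult.commute)
  fix A assume "\<forall>v. frechet_derivative (rot_surface f) (at p) (A *v v)
      = - frechet_derivative (rot_gauss f) (at p) v"
  then have "A *v v = diag_mat ?\<kappa> *v v" for v
    using injD[OF inj_rot_surface_frechet[OF assms]] eq by metis
  then show "A = diag_mat ?\<kappa>" by (simp add: matrix_eq)
qed

text \<open>The first three components are s u with u on the hyperboloid, so their Lorentz square
  determines s up to sign. Opposite parameters are excluded because 0 would lie between them in the
  interval. Injectivity of sinh then recovers t and, after it, w.\<close>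

lemma inj_on_rot_surface:
  assumes "is_interval I" shows "inj_on (rot_surface f) U"
proof (rule inj_onI)
  fix p q assume pq: "p \<in> U" "q \<in> U" and eq: "rot_surface f p = rot_surface f q"
  have norm: "(rot_surface f r $ 1)^2 - (rot_surface f r $ 2)^2 - (rot_surface f r $ 3)^2 = (r$1)^2" for r
    using cosh_square[of "r$2"] cosh_square[of "r$3"]
    by (simp add: rot_surface_def Let_def) algebra
  have "(p$1)^2 = (q$1)^2" using norm[of p] norm[of q] eq by simp
  moreover have "p$1 \<noteq> - q$1"
  proof
    assume "p$1 = - q$1"
    then have "0 \<in> closed_segment (p$1) (q$1)" by (auto simp: closed_segment_eq_real_ivl)
    moreover have "closed_segment (p$1) (q$1) \<subseteq> I"
      using assms pq closed_segment_subset is_interval_convex by (auto simp: U_def)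
    ultimately show False using zero_notin by blast
  qed
  ultimately have s: "p$1 = q$1" by (simp add: power2_eq_iff)
  have s0: "q$1 \<noteq> 0" using pq zero_notin by (auto simp: U_def)
  have "q$1 * sinh (p$2) = q$1 * sinh (q$2)"
    using arg_cong[OF eq, of "\<lambda>x. x $ 2"] s by (simp add: rot_surface_def Let_def)
  then have t: "p$2 = q$2" using s0 by simp
  have "q$1 * cosh (q$2) * sinh (p$3) = q$1 * cosh (q$2) * sinh (q$3)"
    using arg_cong[OF eq, of "\<lambda>x. x $ 3"] s t by (simp add: rot_surface_def Let_def)
  then have "p$3 = q$3" using s0 by simp
  then show "p = q" using s t by (simp add: vec_eq_iff forall_3)
qed

section \<open>Smoothness and orientation of the hypersurface\<close>

lemma smooth_on_coordinate: "smooth_on U (\<lambda>p. p$i)"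
  by (rule smooth_on_bounded_linear[OF open_U bounded_linear_vec_nth])

lemma smooth_on_profile: "smooth_on I h \<Longrightarrow> smooth_on U (\<lambda>p. h (p$1))" for h :: "real \<Rightarrow> real"
  by (rule smooth_on_compose[OF open_U open_I _ smooth_on_coordinate]) (auto simp: U_def)

lemma smooth_on_rot_surface: "smooth_on U (rot_surface f)"
proof (rule smooth_on_vecI[OF open_U])
  fix i :: 4
  consider "i = 1" | "i = 2" | "i = 3" | "i = 4" using exhaust_4 by blast
  then show "smooth_on U (\<lambda>p. rot_surface f p $ i)"
    by cases (auto simp: rot_surface_def Let_def intro!: smooth_on_mult smooth_on_cosh_compose
        smooth_on_sinh_compose smooth_on_coordinate open_U smooth_on_profile smooth_f)
qed

lemma smooth_on_\<nu>: "smooth_on I \<nu>"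
proof (rule smooth_on_cong[OF open_I])
  show "smooth_on I (\<lambda>s. (1 - (f1 s)^2) powr (-1/2))"
    by (intro smooth_on_powr_compose smooth_on_diff smooth_on_const smooth_on_power open_I
        smooth_f123 slope_pos)
  show "(1 - (f1 s)^2) powr (-1/2) = \<nu> s" if "s \<in> I" for s
    using powr_minus_divide[of "1 - (f1 s)^2" "1/2"] powr_half_sqrt[of "1 - (f1 s)^2"] slope_pos[OF that]
    unfolding \<nu>_def by simp
qed

lemma smooth_on_rot_gauss: "smooth_on U (rot_gauss f)"
proof (rule smooth_on_vecI[OF open_U])
  fix i :: 4
  consider "i = 1" | "i = 2" | "i = 3" | "i = 4" using exhaust_4 by blast
  then show "smooth_on U (\<lambda>p. rot_gauss f p $ i)"
    by cases (auto simp: rot_gauss_nth intro!: smooth_on_mult smooth_on_minus smooth_on_cosh_compose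
        smooth_on_sinh_compose smooth_on_coordinate open_U smooth_on_profile[of f1]
        smooth_on_profile[of \<nu>] smooth_f123 smooth_on_\<nu>)
qed

text \<open>Since u has Lorentz square -1, the square of N is k^2 - h^2 = \<nu>^2 (1 - f'^2) = 1, so
  \<epsilon> = 1. Tangency reduces to h = k f' along s and to the orthogonality of u to its
  derivatives in t and w.\<close>

lemma lorentz_rot_gauss:
  assumes "p \<in> U"
  shows "lorentz (rot_gauss f p) (rot_gauss f p) = 1"
    and "lorentz (rot_gauss f p) (frechet_derivative (rot_surface f) (at p) v) = 0"
proof -
  have "(\<nu> (p$1))^2 * (1 - (f1 (p$1))^2) = 1"
    using assms slope_pos[of "p$1"] by (simp add: \<nu>_squared U_def)
  then show "lorentz (rot_gauss f p) (rot_gauss f p) = 1"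
    using cosh_square[of "p$2"] cosh_square[of "p$3"]
    unfolding lorentz_def rot_gauss_nth by algebra
  show "lorentz (rot_gauss f p) (frechet_derivative (rot_surface f) (at p) v) = 0"
    using cosh_square[of "p$2"] cosh_square[of "p$3"]
    unfolding lorentz_def rot_gauss_nth rot_surface_frechet[OF assms]
    by (simp add: X\<^sub>s_def X\<^sub>t_def X\<^sub>w_def) algebra
qed

lemma oriented_hypersurface_rot:
  assumes "is_interval I" shows "oriented_hypersurface U (rot_surface f) (rot_gauss f)"
  unfolding oriented_hypersurface_def
  using open_U inj_on_rot_surface[OF assms] smooth_on_rot_surface smooth_on_rot_gauss
    inj_rot_surface_frechet lorentz_rot_gauss rot_metric_nonzero
  by (simp add: induced_metric_rot_surface det_diag_mat)

section \<open>The operator L_1 on separable functions\<close>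

text \<open>By \<open>eigen\<close> the angular factor satisfies at \<open>p\<close> the eigenvalue
  equation of the Laplacian of the hyperbolic plane in the coordinates (t, w). The summand with
  \<open>2 * \<kappa>2 s\<close> is the contribution of the direction s: its weight in P_1 is
  \<open>- 2 * \<kappa>2 s\<close>, and the sign is absorbed by the negative metric entry. The
  directions t and w share the weight \<open>- (\<kappa>1 s + \<kappa>2 s)\<close>.\<close>

lemma L_op_separable:
  fixes h a b :: "real \<Rightarrow> real" and p :: "real^3"
  assumes p: "p \<in> U"
    and h: "\<And>s. s \<in> I \<Longrightarrow> (h has_real_derivative h1 s) (at s)"
      "\<And>s. s \<in> I \<Longrightarrow> (h1 has_real_derivative h2 s) (at s)"
    and a: "\<And>t. (a has_real_derivative a1 t) (at t)" "\<And>t. (a1 has_real_derivative a2 t) (at t)"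
    and b: "\<And>w. (b has_real_derivative b1 w) (at w)" "\<And>w. (b1 has_real_derivative b2 w) (at w)"
    and \<phi>: "\<And>q. \<phi> q = h (q$1) * a (q$2) * b (q$3)"
    and eigen: "a2 (p$2) * b (p$3) + a (p$2) * b2 (p$3) / (cosh (p$2))^2
        + sinh (p$2) / cosh (p$2) * a1 (p$2) * b (p$3) = e * (a (p$2) * b (p$3))"
  shows "L_op 1 (rot_surface f) (rot_gauss f) \<phi> p =
    (let s = p$1 in
      2 * \<kappa>2 s * (\<nu> s)^2 * (h2 s + f1 s * f2 s * (\<nu> s)^2 * h1 s)
      - (\<kappa>1 s + \<kappa>2 s) * (e * h s / s^2 - 2 * h1 s * (\<nu> s)^2 / s)) * (a (p$2) * b (p$3))"
proof -
  define s t w where "s = p$1" "t = p$2" "w = p$3"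
  note stw = s_t_w_def
  have s: "s \<in> I" "s \<noteq> 0" using p zero_notin by (auto simp: U_def stw)
  define W where "W = 1 - (f1 s)^2"
  have W: "W \<noteq> 0" using slope_pos[OF s(1)] by (simp add: W_def)
  have ct: "cosh t \<noteq> 0" using cosh_real_pos[of t] by simp
  note one = DERIV_const[of 1 "at _"]
  have d\<phi>: "partial 1 \<phi> q = h1 (q$1) * a (q$2) * b (q$3)"
    "partial 2 \<phi> q = h (q$1) * a1 (q$2) * b (q$3)"
    "partial 3 \<phi> q = h (q$1) * a (q$2) * b1 (q$3)" if "q \<in> U" for q
  proof -
    have eq: "\<phi> = (\<lambda>q. h (q$1) * a (q$2) * b (q$3))" using \<phi> by blast
    have "q$1 \<in> I" using that by (simp add: U_def)
    note partial_separable[OF h(1)[OF this] a(1) b(1)]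
    then show "partial 1 \<phi> q = h1 (q$1) * a (q$2) * b (q$3)"
      "partial 2 \<phi> q = h (q$1) * a1 (q$2) * b (q$3)"
      "partial 3 \<phi> q = h (q$1) * a (q$2) * b1 (q$3)" unfolding eq .
  qed
  have dW: "((\<lambda>s. 1 - (f1 s)^2) has_real_derivative - (2 * f1 s * f2 s)) (at s)"
    by (auto intro!: derivative_eq_intros DERIV_f(2) s)
  have dg1: "partial 1 (\<lambda>q. rot_metric q $ 1) p = 2 * f1 s * f2 s"
    "partial 2 (\<lambda>q. rot_metric q $ 1) p = 0" "partial 3 (\<lambda>q. rot_metric q $ 1) p = 0"
    using partial_separable[OF DERIV_minus[OF dW[unfolded stw]] one one] by (simp_all add: rot_metric_def stw)
  have ds2: "((\<lambda>s. s^2) has_real_derivative 2 * s) (at s)"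
    by (auto intro!: derivative_eq_intros)
  have dg2: "partial 1 (\<lambda>q. rot_metric q $ 2) p = 2 * s"
    "partial 2 (\<lambda>q. rot_metric q $ 2) p = 0" "partial 3 (\<lambda>q. rot_metric q $ 2) p = 0"
    using partial_separable[OF ds2[unfolded stw] one one] by (simp_all add: rot_metric_def stw)
  have dc2: "((\<lambda>t. (cosh t)^2) has_real_derivative 2 * cosh t * sinh t) (at t)"
    by (auto intro!: derivative_eq_intros)
  have dg3: "partial 1 (\<lambda>q. rot_metric q $ 3) p = 2 * s * (cosh t)^2"
    "partial 2 (\<lambda>q. rot_metric q $ 3) p = s^2 * (2 * cosh t * sinh t)"
    "partial 3 (\<lambda>q. rot_metric q $ 3) p = 0"
    using partial_separable[OF ds2[unfolded stw] dc2[unfolded stw] one]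
    by (simp_all add: rot_metric_def stw)
  \<comment> \<open>Up to \<open>H3\<close>, each component of the gradient is differentiated in its
    own direction; it is again separable near \<open>p\<close>.\<close>
  have "((\<lambda>s. - (h1 s / (1 - (f1 s)^2))) has_real_derivative
      - (h2 s / W + 2 * f1 s * f2 s * h1 s / W^2)) (at s)"
    using DERIV_minus[OF DERIV_divide[OF h(2)[OF s(1)] dW W[unfolded W_def]]] W
    unfolding W_def[symmetric] by (simp add: field_simps power2_eq_square)
  note partial_separable(1)[OF this[unfolded stw] a(1) b(1)]
  moreover have "partial 1 (\<lambda>q. partial 1 \<phi> q / rot_metric q $ 1) p
      = partial 1 (\<lambda>q. - (h1 (q$1) / (1 - (f1 (q$1))^2)) * a (q$2) * b (q$3)) p"
    by (rule dir_deriv_cong_open[OF open_U p]) (simp add: d\<phi> rot_metric_def divide_simps, simp add: algebra_simps)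
  ultimately have H1: "partial 1 (\<lambda>q. partial 1 \<phi> q / rot_metric q $ 1) p
      = - (h2 s / W + 2 * f1 s * f2 s * h1 s / W^2) * a t * b w"
    by (simp add: stw)
  have hs: "((\<lambda>s. h s / s^2) has_real_derivative (h1 s * s^2 - h s * (2 * s)) / (s^2 * s^2)) (at s)"
    using DERIV_divide[OF h(1)[OF s(1)] ds2] s(2) by simp
  have "partial 2 (\<lambda>q. partial 2 \<phi> q / rot_metric q $ 2) p
      = partial 2 (\<lambda>q. (h (q$1) / (q$1)^2) * a1 (q$2) * b (q$3)) p"
    by (rule dir_deriv_cong_open[OF open_U p]) (simp add: d\<phi> rot_metric_def)
  then have H2: "partial 2 (\<lambda>q. partial 2 \<phi> q / rot_metric q $ 2) p = h s / s^2 * a2 t * b w"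
    using partial_separable(2)[OF hs[unfolded stw] a(2) b(1)] by (simp add: stw)
  have at: "((\<lambda>t. a t / (cosh t)^2) has_real_derivative
      (a1 t * (cosh t)^2 - a t * (2 * cosh t * sinh t)) / ((cosh t)^2 * (cosh t)^2)) (at t)"
    using DERIV_divide[OF a(1) dc2] ct by simp
  have "partial 3 (\<lambda>q. partial 3 \<phi> q / rot_metric q $ 3) p
      = partial 3 (\<lambda>q. (h (q$1) / (q$1)^2) * (a (q$2) / (cosh (q$2))^2) * b1 (q$3)) p"
    by (rule dir_deriv_cong_open[OF open_U p]) (simp add: d\<phi> rot_metric_def)
  then have H3: "partial 3 (\<lambda>q. partial 3 \<phi> q / rot_metric q $ 3) p
      = h s / s^2 * (a t / (cosh t)^2) * b2 w"
    using partial_separable(3)[OF hs[unfolded stw] at[unfolded stw] b(2)] by (simp add: stw)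
  have g: "rot_metric p $ 1 = - W" "rot_metric p $ 2 = s^2" "rot_metric p $ 3 = s^2 * (cosh t)^2"
    by (simp_all add: rot_metric_def W_def stw)
  have L: "L_op 1 (rot_surface f) (rot_gauss f) \<phi> p
    = (\<Sum>i\<in>UNIV. ((vector [\<kappa>1 s, \<kappa>2 s, \<kappa>2 s] :: real^3) $ i
        - ((vector [\<kappa>1 s, \<kappa>2 s, \<kappa>2 s] :: real^3) $ 1 + (vector [\<kappa>1 s, \<kappa>2 s, \<kappa>2 s] :: real^3) $ 2
          + (vector [\<kappa>1 s, \<kappa>2 s, \<kappa>2 s] :: real^3) $ 3)) *
      (partial i (\<lambda>q. partial i \<phi> q / rot_metric q $ i) p
       + (\<Sum>k\<in>UNIV. partial k (\<lambda>q. rot_metric q $ i) p / (2 * rot_metric p $ i)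
            * (partial k \<phi> p / rot_metric p $ k))))"
    using open_U p induced_metric_rot_surface rot_metric_nonzero shape_operator_rot_surface[OF p]
    unfolding stw by (rule L_op_1_orthogonal)
  define K1 K2 where "K1 = \<kappa>1 s" "K2 = \<kappa>2 s"
  \<comment> \<open>Besides the second derivatives, four Christoffel terms survive: one from the
    s-dependence of the first metric entry, the factor 1/s once in each of the directions t and w,
    and tanh t in the direction w.\<close>
  have "L_op 1 (rot_surface f) (rot_gauss f) \<phi> p
    = (K1 - (K1 + K2 + K2)) * (- (h2 s / W + 2 * f1 s * f2 s * h1 s / W^2) * a t * b w
         + 2 * f1 s * f2 s / (2 * - W) * (h1 s * a t * b w / - W))
      + (K2 - (K1 + K2 + K2)) * (h s / s^2 * a2 t * b w + 2 * s / (2 * s^2) * (h1 s * a t * b w / - W))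
      + (K2 - (K1 + K2 + K2)) * (h s / s^2 * (a t / (cosh t)^2) * b2 w
         + (2 * s * (cosh t)^2 / (2 * (s^2 * (cosh t)^2)) * (h1 s * a t * b w / - W)
           + s^2 * (2 * cosh t * sinh t) / (2 * (s^2 * (cosh t)^2)) * (h s * a1 t * b w / s^2)))"
    unfolding L sum_3 H1 H2 H3 dg1 dg2 dg3 d\<phi>[OF p] g K1_K2_def vector_3 stw[symmetric]
    by (simp only: div_0 mult_zero_left add_0_right)
  \<comment> \<open>The tanh term completes the second derivatives in t and w to the hyperbolic
    Laplacian; the two 1/s terms combine into the summand with \<open>h1\<close>.\<close>
  also have "\<dots> = 2 * K2 * (h2 s / W + f1 s * f2 s * h1 s / W^2) * (a t * b w)
      - (K1 + K2) * (h s / s^2 * (a2 t * b w + a t * b2 w / (cosh t)^2 + sinh t / cosh t * a1 t * b w)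
          - 2 * h1 s / (s * W) * (a t * b w))"
    using s(2) W ct by (simp add: field_simps power2_eq_square)
  also have "a2 t * b w + a t * b2 w / (cosh t)^2 + sinh t / cosh t * a1 t * b w = e * (a t * b w)"
    using eigen by (simp add: stw)
  also have "2 * K2 * (h2 s / W + f1 s * f2 s * h1 s / W^2) * (a t * b w)
      - (K1 + K2) * (h s / s^2 * (e * (a t * b w)) - 2 * h1 s / (s * W) * (a t * b w))
    = (2 * K2 * (1 / W) * (h2 s + f1 s * f2 s * (1 / W) * h1 s)
      - (K1 + K2) * (e * h s / s^2 - 2 * h1 s * (1 / W) / s)) * (a t * b w)"
    using s(2) W by (simp add: field_simps power2_eq_square)
  finally show ?thesis
    unfolding Let_def K1_K2_def W_def stw \<nu>_squared[OF s(1)[unfolded stw]] .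
qed

section \<open>The two coefficient functions as expressions in \<nu>\<close>

text \<open>This is the quotient of L_1 (h u) by h u: the first summand comes from the direction s,
  the second from t and w together.\<close>

lemma rot_m_\<nu>:
  assumes "s \<in> I" "f1 s \<noteq> 0"
  shows "rot_m f s = 2 / s * (f3 s * \<nu> s^5 + 4 * f1 s * (f2 s)^2 * \<nu> s^7)
    - 2 / f1 s * (f2 s * (\<nu> s)^2 + f1 s / s) * (f1 s * \<nu> s / s^2 - f2 s * (\<nu> s)^5 / s)"
proof -
  define p q r v W where d: "p = f1 s" "q = f2 s" "r = f3 s" "v = \<nu> s" "W = 1 - (f1 s)^2"
  have nz: "s \<noteq> 0" "p \<noteq> 0" "v \<noteq> 0" using assms zero_notin \<nu>_pos[OF assms(1)] by (auto simp: d)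
  have p2: "p^2 = 1 - W" by (simp add: d)
  have Wv: "W * v^2 = 1" using slope_pos[OF assms(1)] by (simp add: d \<nu>_squared[OF assms(1)])
  have powr: "W powr (7/2) = 1 / v^7"
    using powr_seven_halves[OF slope_pos[OF assms(1)] refl] by (simp add: d \<nu>_def)
  have "rot_m f s = - ((- 2 * (p^2 - 1)^3 * p^2 + 2 * s * (p^2 - 1) * p^3 * q
          - 2 * s^2 * ((4 * p^2 + 1) * q^2 - (p^2 - 1) * p * r)) / (s^3 * p * W powr (7/2)))"
    by (simp add: rot_m_def Let_def d eval_nat_numeral)
  also have "\<dots> = - (v^7 * (- 2 * (p^2 - 1)^3 * p^2 + 2 * s * (p^2 - 1) * p^3 * q
          - 2 * s^2 * ((4 * p^2 + 1) * q^2 - (p^2 - 1) * p * r)) / (s^3 * p))"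
    unfolding powr by simp
  \<comment> \<open>A polynomial identity modulo the relations \<open>p2\<close> and
    \<open>Wv\<close>.\<close>
  also have "- (v^7 * (- 2 * (p^2 - 1)^3 * p^2 + 2 * s * (p^2 - 1) * p^3 * q
          - 2 * s^2 * ((4 * p^2 + 1) * q^2 - (p^2 - 1) * p * r)))
     = 2 * s^2 * p * (r * v^5 + 4 * p * q^2 * v^7) - 2 * (q * v^2 * s + p) * (p * v - q * v^5 * s)"
    using p2 Wv by algebra
  then have "- (v^7 * (- 2 * (p^2 - 1)^3 * p^2 + 2 * s * (p^2 - 1) * p^3 * q
          - 2 * s^2 * ((4 * p^2 + 1) * q^2 - (p^2 - 1) * p * r)) / (s^3 * p))
     = (2 * s^2 * p * (r * v^5 + 4 * p * q^2 * v^7) - 2 * (q * v^2 * s + p) * (p * v - q * v^5 * s)) / (s^3 * p)"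
    by (simp only: minus_divide_left)
  also have "\<dots> = 2 / s * (r * v^5 + 4 * p * q^2 * v^7)
    - 2 / p * (q * v^2 + p / s) * (p * v / s^2 - q * v^5 / s)"
    using nz by (simp add: field_simps power2_eq_square power3_eq_cube)
  finally show ?thesis by (simp add: d)
qed

text \<open>As 1 / (1 - f'^2)^3 = \<nu>^6, the quotient becomes a polynomial over s^3 f', the common
  denominator in the comparison with \<open>rot_m\<close>.\<close>

lemma rot_n_\<nu>:
  assumes "s \<in> I" "f1 s \<noteq> 0" "c \<noteq> 0"
  shows "rot_n f c s * c = (2 * s^2 * f1 s * f3 s * (\<nu> s)^4 - 2 * (f1 s)^2 * (\<nu> s)^2
      + (6 * (f1 s)^2 + 2) * s^2 * (f2 s)^2 * (\<nu> s)^6) / (s^3 * f1 s)"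
proof -
  define p q r v W where d: "p = f1 s" "q = f2 s" "r = f3 s" "v = \<nu> s" "W = 1 - (f1 s)^2"
  have nz: "s \<noteq> 0" "p \<noteq> 0" "W \<noteq> 0"
    using assms zero_notin slope_pos[OF assms(1)] by (auto simp: d)
  have p2: "p^2 - 1 = - W" by (simp add: d)
  have Wv: "W * v^2 = 1" using slope_pos[OF assms(1)] by (simp add: d \<nu>_squared[OF assms(1)])
  have "rot_n f c s = (2 * (s^2 * r * (p^2 - 1) + p * ((p^2 - 1)^2 - 3 * s^2 * q^2)) * p - 2 * s^2 * q^2)
      / (c * s^3 * p * (p^2 - 1)^3)"
    by (simp add: rot_n_def Let_def d eval_nat_numeral)
  then have "rot_n f c s * c = (2 * (s^2 * r * - W + p * (W^2 - 3 * s^2 * q^2)) * p - 2 * s^2 * q^2)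
      / (- (s^3 * p * W^3))"
    unfolding p2 using assms(3) by (simp add: power3_eq_cube)
  \<comment> \<open>The fraction is expanded by \<open>W^3\<close>, which \<open>Wv\<close> cancels
    against the powers of \<open>v\<close>; the sign of the old denominator moves to the
    numerator.\<close>
  also have "\<dots> = (2 * s^2 * p * r * v^4 - 2 * p^2 * v^2 + (6 * p^2 + 2) * s^2 * q^2 * v^6)
      * W^3 / (s^3 * p * W^3)"
  proof -
    have "v^2 * W^3 = W^2" "v^4 * W^3 = W" "v^6 * W^3 = 1" using Wv by algebra+
    moreover have "(2 * s^2 * p * r * v^4 - 2 * p^2 * v^2 + (6 * p^2 + 2) * s^2 * q^2 * v^6) * W^3
      = 2 * s^2 * p * r * (v^4 * W^3) - 2 * p^2 * (v^2 * W^3) + (6 * p^2 + 2) * s^2 * q^2 * (v^6 * W^3)"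
      by (simp add: algebra_simps)
    ultimately have "- (2 * (s^2 * r * - W + p * (W^2 - 3 * s^2 * q^2)) * p - 2 * s^2 * q^2)
      = (2 * s^2 * p * r * v^4 - 2 * p^2 * v^2 + (6 * p^2 + 2) * s^2 * q^2 * v^6) * W^3"
      by (simp add: algebra_simps power2_eq_square)
    then show ?thesis unfolding minus_divide_divide[symmetric, of _ "- _"] minus_minus by simp
  qed
  finally show ?thesis using nz by (simp add: d(1-4))
qed

lemma sinh_square: "(sinh x)^2 = (cosh x)^2 - 1" for x :: real
  by (simp add: cosh_square)

lemma DERIV_f1_\<nu>_second:
  assumes "s \<in> I"
  shows "((\<lambda>s. - (f2 s * (\<nu> s)^3)) has_real_derivative
    - (f3 s * (\<nu> s)^3 + 3 * f1 s * (f2 s)^2 * (\<nu> s)^5)) (at s)"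
  using DERIV_minus[OF DERIV_mult[OF DERIV_f(3)[OF assms] DERIV_power[OF DERIV_\<nu>[OF assms], of 3]]]
  by (simp add: algebra_simps eval_nat_numeral)

lemma DERIV_\<nu>_second:
  assumes "s \<in> I"
  shows "((\<lambda>s. - (f1 s * f2 s * (\<nu> s)^3)) has_real_derivative
    - ((f2 s)^2 * (\<nu> s)^3 + f1 s * f3 s * (\<nu> s)^3 + 3 * (f1 s)^2 * (f2 s)^2 * (\<nu> s)^5)) (at s)"
  using DERIV_minus[OF DERIV_mult[OF DERIV_mult[OF DERIV_f(2,3)[OF assms]]
        DERIV_power[OF DERIV_\<nu>[OF assms], of 3]]]
  by (simp add: algebra_simps eval_nat_numeral)

text \<open>The factor from \<open>L_op_separable\<close> for h = - f' \<nu> and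
  \<open>e = 2\<close>; it is h times \<open>rot_m\<close>.\<close>

lemma radial_coefficient:
  assumes s: "s \<in> I" "f1 s \<noteq> 0"
  shows "2 * \<kappa>2 s * (\<nu> s)^2 * (- (f3 s * (\<nu> s)^3 + 3 * f1 s * (f2 s)^2 * (\<nu> s)^5)
        + f1 s * f2 s * (\<nu> s)^2 * - (f2 s * (\<nu> s)^3))
      - (\<kappa>1 s + \<kappa>2 s) * (2 * - (f1 s * \<nu> s) / s^2 - 2 * - (f2 s * (\<nu> s)^3) * (\<nu> s)^2 / s)
    = rot_m f s * - (f1 s * \<nu> s)"
proof -
  have "s \<noteq> 0" using s zero_notin by auto
  then show ?thesis using s(2)
    unfolding rot_m_\<nu>[OF s] \<kappa>1_def \<kappa>2_def by (simp add: field_simps eval_nat_numeral)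
qed

text \<open>The factor \<open>0\<close> is the eigenvalue \<open>e\<close> of a constant function in \<open>L_op_separable\<close>.\<close>

lemma axial_coefficient:
  assumes s: "s \<in> I" "f1 s \<noteq> 0" and "c \<noteq> 0"
  shows "2 * \<kappa>2 s * (\<nu> s)^2
      * (- ((f2 s)^2 * (\<nu> s)^3 + f1 s * f3 s * (\<nu> s)^3 + 3 * (f1 s)^2 * (f2 s)^2 * (\<nu> s)^5)
        + f1 s * f2 s * (\<nu> s)^2 * - (f1 s * f2 s * (\<nu> s)^3))
      - (\<kappa>1 s + \<kappa>2 s) * (0 * - \<nu> s / s^2 - 2 * - (f1 s * f2 s * (\<nu> s)^3) * (\<nu> s)^2 / s)
    = rot_m f s * - \<nu> s + rot_n f c s * c"
proof -
  define p q r v where d: "p = f1 s" "q = f2 s" "r = f3 s" "v = \<nu> s"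
  have nz: "s \<noteq> 0" "p \<noteq> 0" using s zero_notin by (auto simp: d)
  have R: "v^2 - p^2 * v^2 - 1 = 0"
    using slope_pos[OF s(1)] unfolding d \<nu>_squared[OF s(1)] by (simp add: field_simps)
  \<comment> \<open>After multiplication by \<open>s^3 * p\<close>, \<open>A\<close> is the
    left-hand side, \<open>B\<close> is the product of \<open>rot_m\<close> and \<nu>, and
    \<open>C\<close> is the product of \<open>rot_n\<close> and \<open>c\<close>.\<close>
  define A B C where ABC:
    "A = - 2 * p^2 * s^2 * v^3 * (q^2 * v^3 + p * r * v^3 + 4 * p^2 * q^2 * v^5)
      - 2 * s * p * (s * q * v^3 + p * v) * p * q * v^5"
    "B = v * (2 * s^2 * p * (r * v^5 + 4 * p * q^2 * v^7) - 2 * (q * v^2 * s + p) * (p * v - q * v^5 * s))"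
    "C = 2 * s^2 * p * r * v^4 - 2 * p^2 * v^2 + (6 * p^2 + 2) * s^2 * q^2 * v^6"
  \<comment> \<open>The claim holds only modulo the relation \<open>R\<close> between
    \<open>v\<close> and \<open>p\<close>; the second factor is the explicit cofactor.\<close>
  have "A + B - C = (v^2 - p^2 * v^2 - 1)
      * (2 * s^2 * p * r * v^4 + s^2 * (8 * p^2 + 2) * q^2 * v^6 + 2 * s * p * q * v^4)"
    unfolding ABC by (simp add: algebra_simps eval_nat_numeral)
  then have "A = - B + C" unfolding R by simp
  then have "A / (s^3 * p) = - (B / (s^3 * p)) + C / (s^3 * p)" by (simp add: diff_divide_distrib)
  moreover have "2 * (p * v / s) * v^2 * (- (q^2 * v^3 + p * r * v^3 + 3 * p^2 * q^2 * v^5)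
        + p * q * v^2 * - (p * q * v^3))
      - (q * v^3 + p * v / s) * (0 * - v / s^2 - 2 * - (p * q * v^3) * v^2 / s) = A / (s^3 * p)"
    unfolding ABC using nz by (simp add: field_simps eval_nat_numeral)
  moreover have "rot_m f s * v = B / (s^3 * p)"
    unfolding rot_m_\<nu>[OF s] d[symmetric] ABC using nz by (simp add: field_simps eval_nat_numeral)
  moreover have "rot_n f c s * c = C / (s^3 * p)"
    unfolding rot_n_\<nu>[OF assms] d[symmetric] ABC ..
  ultimately show ?thesis unfolding \<kappa>1_def \<kappa>2_def d[symmetric] by simp
qed

lemma L_op_rot_gauss:
  assumes p: "p \<in> U" and slope0: "f1 (p$1) \<noteq> 0" and c: "c \<noteq> 0"
  shows "L_op_vec 1 (rot_surface f) (rot_gauss f) (rot_gauss f) p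
    = rot_m f (p$1) *\<^sub>R rot_gauss f p + rot_n f c (p$1) *\<^sub>R vector [0, 0, 0, c]"
proof -
  have s: "p$1 \<in> I" using p by (simp add: U_def)
  have ct: "cosh (p$2) \<noteq> 0" using cosh_real_pos[of "p$2"] by simp
  note ch = DERIV_cosh_real and sh = DERIV_sinh_real and const = DERIV_const
  \<comment> \<open>Eigenvalue 2 belongs to the components of u, hence to the first three components
    of N.\<close>
  note radial = L_op_separable[OF p DERIV_f1_\<nu> DERIV_f1_\<nu>_second, where e = 2,
      unfolded Let_def radial_coefficient[OF s slope0]]
  \<comment> \<open>The last component of N depends on s alone, so its angular factor is
    constant.\<close>
  note axial = L_op_separable[OF p DERIV_minus[OF DERIV_\<nu>] DERIV_\<nu>_second, where e = 0,
      unfolded Let_def axial_coefficient[OF s slope0 c]]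
  have "L_op 1 (rot_surface f) (rot_gauss f) (\<lambda>q. rot_gauss f q $ 1) p
      = rot_m f (p$1) * - (f1 (p$1) * \<nu> (p$1)) * (cosh (p$2) * cosh (p$3))"
    by (rule radial[OF _ _ ch sh ch sh rot_gauss_nth(1)])
      (use ct in \<open>simp_all add: field_simps power2_eq_square sinh_square[unfolded power2_eq_square]\<close>)
  moreover have "L_op 1 (rot_surface f) (rot_gauss f) (\<lambda>q. rot_gauss f q $ 2) p
      = rot_m f (p$1) * - (f1 (p$1) * \<nu> (p$1)) * (sinh (p$2) * 1)"
    by (rule radial[OF _ _ sh ch const const rot_gauss_nth(2)])
      (use ct in \<open>simp_all add: field_simps\<close>)
  moreover have "L_op 1 (rot_surface f) (rot_gauss f) (\<lambda>q. rot_gauss f q $ 3) p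
      = rot_m f (p$1) * - (f1 (p$1) * \<nu> (p$1)) * (cosh (p$2) * sinh (p$3))"
    by (rule radial[OF _ _ ch sh sh ch rot_gauss_nth(3)])
      (use ct in \<open>simp_all add: field_simps power2_eq_square sinh_square[unfolded power2_eq_square]\<close>)
  moreover have "L_op 1 (rot_surface f) (rot_gauss f) (\<lambda>q. rot_gauss f q $ 4) p
      = (rot_m f (p$1) * - \<nu> (p$1) + rot_n f c (p$1) * c) * (1 * 1)"
    by (rule axial[OF _ _ const const const const rot_gauss_nth(4)]) simp_all
  ultimately show ?thesis
    by (simp add: L_op_vec_def vec_eq_iff forall_4 rot_gauss_nth)
qed

lemma smooth_on_rot_coefficients:
  assumes "\<And>s. s \<in> I \<Longrightarrow> f1 s \<noteq> 0" "c \<noteq> 0"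
  shows "smooth_on U (\<lambda>p. rot_m f (p$1))" "smooth_on U (\<lambda>p. rot_n f c (p$1))"
proof -
  have higher: "(deriv ^^ 2) f = f2" "(deriv ^^ 3) f = f3"
    by (simp_all add: eval_nat_numeral)
  have id: "smooth_on I (\<lambda>s. s)"
    by (rule smooth_on_bounded_linear[OF open_I bounded_linear_ident])
  have nz: "s \<noteq> 0" "f1 s \<noteq> 0" "1 - (f1 s)^2 > 0" "(f1 s)^2 - 1 \<noteq> 0" if "s \<in> I" for s
    using that assms zero_notin slope_pos[OF that] by auto
  note smooth = smooth_on_minus smooth_on_add smooth_on_diff smooth_on_mult smooth_on_divide
    smooth_on_power smooth_on_powr_compose smooth_on_const open_I smooth_f123 id
  have "smooth_on I (rot_m f)"
    unfolding rot_m_def Let_def higher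
    by (intro smooth) (use nz in \<open>auto simp: less_le\<close>)
  then show "smooth_on U (\<lambda>p. rot_m f (p$1))" by (rule smooth_on_profile)
  have "smooth_on I (rot_n f c)"
    unfolding rot_n_def Let_def higher
    by (intro smooth) (use nz assms(2) in auto)
  then show "smooth_on U (\<lambda>p. rot_n f c (p$1))" by (rule smooth_on_profile)
qed

end

theorem theorem3:
  fixes I :: "real set" and f :: "real \<Rightarrow> real" and C4 :: real and U :: "(real^3) set"
  assumes I: "open I" "is_interval I" "0 \<notin> I"
    and f: "smooth_on I f" "\<forall>s\<in>I. (deriv f s)^2 < 1" "\<forall>s\<in>I. deriv f s \<noteq> 0"
    and C4: "C4 \<noteq> 0"
    and m_nonzero: "\<exists>s\<in>I. rot_m f s \<noteq> 0"
    and n_nonzero: "\<exists>s\<in>I. rot_n f C4 s \<noteq> 0"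
    and U: "U = {p. p$1 \<in> I}"
  shows "oriented_hypersurface U (rot_surface f) (rot_gauss f)
    \<and> generalized_L_1_type_Gauss_map 1 U (rot_surface f) (rot_gauss f)
    \<and> (\<forall>p\<in>U. L_op_vec 1 (rot_surface f) (rot_gauss f) (rot_gauss f) p
          = rot_m f (p$1) *\<^sub>R rot_gauss f p + rot_n f C4 (p$1) *\<^sub>R vector [0, 0, 0, C4])"
proof -
  interpret rot: rot_profile I f using I f by unfold_locales auto
  have U_eq: "rot.U = U" unfolding rot.U_def U ..
  have L: "\<forall>p\<in>U. L_op_vec 1 (rot_surface f) (rot_gauss f) (rot_gauss f) p
      = rot_m f (p$1) *\<^sub>R rot_gauss f p + rot_n f C4 (p$1) *\<^sub>R vector [0, 0, 0, C4]"
    using rot.L_op_rot_gauss[OF _ _ C4] f(3) by (simp add: U_eq U)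
  have smooth: "smooth_on U (\<lambda>p. rot_m f (p$1))" "smooth_on U (\<lambda>p. rot_n f C4 (p$1))"
    using rot.smooth_on_rot_coefficients[OF _ C4] f(3) unfolding U_eq by auto
  \<comment> \<open>Both coefficients depend on s only; a parameter where one is non-zero lifts to
    the point with t = w = 0.\<close>
  have "\<exists>p\<in>U. P (p$1)" if "\<exists>s\<in>I. P s" for P
  proof -
    obtain s where "s \<in> I" "P s" using \<open>\<exists>s\<in>I. P s\<close> by blast
    then show ?thesis by (intro bexI[of _ "vector [s, 0, 0]"]) (simp_all add: U)
  qed
  note nonzero = this[OF m_nonzero] this[OF n_nonzero]
  have "(vector [0, 0, 0, C4] :: real^4) \<noteq> 0"
    using C4 by (simp add: vec_eq_iff forall_4)
  with smooth nonzero L have "generalized_L_1_type_Gauss_map 1 U (rot_surface f) (rot_gauss f)"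
    unfolding generalized_L_1_type_Gauss_map_def
    by (intro exI[of _ "\<lambda>p. rot_m f (p$1)"] exI[of _ "\<lambda>p. rot_n f C4 (p$1)"]
        exI[of _ "vector [0, 0, 0, C4]"]) blast
  then show ?thesis using rot.oriented_hypersurface_rot[OF I(2)] L unfolding U_eq by blast
qed

end
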